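(* Let $1\le k<n$, let $K\in\mathbb{R}^{n\times n}$ be symmetric positive semidefinite with $\operatorname{rank}(K)\ge k$, let $\eta>0$ and $f>1$. Let $S$ be a selection operator obtained from the CholeskyGKS algorithm (described in the context) with greedy pivoted Cholesky for the low-rank approximation and sRRQR with parameter $f$ for the pivoted QR step. Let $S_{\rm opt}$ be a selection operator maximizing $\phi_D$ over all selection operators with $k$ columns. Then $$\phi_D(S_{\rm opt})\ \ge\ \phi_D(S)\ \ge\ \log\det\left(I_k+\frac{\eta^{-2}\Lambda_kC}{1+f^2k(n-k)}\right),$$ where $C\in\mathbb{R}^{k\times k}$ is the diagonal matrix with diagonal entries $c_{ii}=[4^{i-1}(n-i+1)]^{-1}$ for $1\le i\le k$.
   Context: A selection operator $S\in\mathbb{R}^{n\times k}$ is a matrix whose columns are $k$ distinct columns of $I_n$. The D-optimality criterion is $\phi_D(S):=\log\det(\eta^{-2}S^\top KS+I_k)$. Eigenvalues are in non-increasing order $\lambda_1(K)\ge\dots\ge\lambda_n(K)\ge0$, and $\Lambda_k=\operatorname{diag}(\lambda_1(K),\dots,\lambda_k(K))$. Greedy pivoted Cholesky: set $K^{(0)}=0$, $E^{(0)}=K$. For $j=1,\dots,k$ choose a pivot $s_j\in\arg\max_{1\le i\le n}e_i^\top E^{(j-1)}e_i$ (ties broken arbitrarily), set $w_j=E^{(j-1)}e_{s_j}$, and update $$K^{(j)}=K^{(j-1)}+\frac{w_jw_j^\top}{e_{s_j}^\top w_j},\qquad E^{(j)}=E^{(j-1)}-\frac{w_jw_j^\top}{e_{s_j}^\top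 w_j}.$$ The output is $F\in\mathbb{R}^{n\times k}$ with columns $w_j/\sqrt{e_{s_j}^\top w_j}$, so that $\widehat K:=K^{(k)}=FF^\top\approx K$. CholeskyGKS algorithm: (1) compute $F\in\mathbb{R}^{n\times k}$ by pivoted Cholesky of $K$; (2) let $U_k\in\mathbb{R}^{n\times k}$ be the left singular vectors in a thin SVD of $F$ (orthonormal eigenvectors of $\widehat K=FF^\top$ for its $k$ largest eigenvalues); (3) apply a pivoted QR factorization to $U_k^\top$, and output the selection operator $S$ formed by the first $k$ columns of the permutation matrix. sRRQR (Gu--Eisenstat, for short and wide matrices): given $A\in\mathbb{R}^{k\times n}$ with $\operatorname{rank}(A)=k<n$ and a parameter $f>1$, it produces a permutation matrix $\Pi=[S\ \ P]\in\mathbb{R}^{n\times n}$, with $S\in\mathbb{R}^{n\times k}$ the first $k$ columns, and a QR factorization $A\Pi=Q[R_{11}\ \ R_{12}]$ with $Q\in\mathbb{R}^{k\times k}$ orthogonal and $R_{11}\in\mathbb{R}^{k\times k}$ upper triangular and nonsingular, such that $$\sigma_i(A)\ge\sigma_i(R_{11})\ge\frac{\sigma_i(A)}{\sqrt{1+f^2k(n-k)}},\qquad1\le i\le k,$$ where $\sigma_i$ denotes the $i$-th largest singular value. *)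

theory Defs
  imports
    Complex_Main
    "HOL-Combinatorics.Permutations"
    "Jordan_Normal_Form.Char_Poly"
    "Jordan_Normal_Form.DL_Rank"
begin

text \<open>Matrix, vector and step indices start at 0, as in \<^theory>\<open>Jordan_Normal_Form.Matrix\<close>;
  eigenvalues and singular values are counted from 1.\<close>

definition psd_mat :: "nat \<Rightarrow> real mat \<Rightarrow> bool" where
  "psd_mat n K \<longleftrightarrow> K \<in> carrier_mat n n \<and> transpose_mat K = K \<and>
     (\<forall>x \<in> carrier_vec n. 0 \<le> x \<bullet> (K *\<^sub>v x))"

text \<open>The real eigenvalues with algebraic multiplicity, in non-increasing order. For a symmetric
  matrix of order \<open>n\<close> the list has length \<open>n\<close>; other matrices are never considered.\<close>

definition eigenvalues_desc :: "real mat \<Rightarrow> real list" where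
  "eigenvalues_desc A = rev (sorted_list_of_multiset (proots (char_poly A)))"

definition nth_eigenvalue :: "real mat \<Rightarrow> nat \<Rightarrow> real" where
  "nth_eigenvalue A i = eigenvalues_desc A ! (i - 1)"

definition singular_value :: "real mat \<Rightarrow> nat \<Rightarrow> real" where
  "singular_value A i = sqrt (nth_eigenvalue (transpose_mat A * A) i)"

definition selection_operator :: "nat \<Rightarrow> nat \<Rightarrow> real mat \<Rightarrow> bool" where
  "selection_operator n k S \<longleftrightarrow> S \<in> carrier_mat n k \<and>
     distinct (cols S) \<and> set (cols S) \<subseteq> set (cols (1\<^sub>m n))"

definition phi_D :: "real mat \<Rightarrow> real \<Rightarrow> real mat \<Rightarrow> real" where
  "phi_D K \<eta> S =
     ln (det ((1 / \<eta>\<^sup>2) \<cdot>\<^sub>m (transpose_mat S * K * S) + 1\<^sub>m (dim_col S)))"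

definition D_optimal :: "nat \<Rightarrow> nat \<Rightarrow> real mat \<Rightarrow> real \<Rightarrow> real mat \<Rightarrow> bool" where
  "D_optimal n k K \<eta> S \<longleftrightarrow> selection_operator n k S \<and>
     (\<forall>T. selection_operator n k T \<longrightarrow> phi_D K \<eta> T \<le> phi_D K \<eta> S)"

definition outer_prod :: "real vec \<Rightarrow> real mat" where
  "outer_prod w = mat (dim_vec w) (dim_vec w) (\<lambda>(a, b). w $ a * w $ b)"

text \<open>Pivoted Cholesky along a pivot sequence \<open>s\<close>, where \<open>s j\<close> is the pivot of step
  \<open>j + 1\<close>. The residual after \<open>j\<close> steps is \<open>E\<^sup>(\<^sup>j\<^sup>)\<close>.\<close>

fun chol_residual :: "real mat \<Rightarrow> (nat \<Rightarrow> nat) \<Rightarrow> nat \<Rightarrow> real mat" where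
  "chol_residual K s 0 = K"
| "chol_residual K s (Suc j) =
     (let E = chol_residual K s j; w = col E (s j)
      in E - (1 / w $ s j) \<cdot>\<^sub>m outer_prod w)"

definition greedy_pivots :: "nat \<Rightarrow> nat \<Rightarrow> real mat \<Rightarrow> (nat \<Rightarrow> nat) \<Rightarrow> bool" where
  "greedy_pivots n k K s \<longleftrightarrow>
     (\<forall>j<k. s j < n \<and>
        (\<forall>i<n. chol_residual K s j $$ (i, i) \<le> chol_residual K s j $$ (s j, s j)))"

definition chol_factor :: "nat \<Rightarrow> nat \<Rightarrow> real mat \<Rightarrow> (nat \<Rightarrow> nat) \<Rightarrow> real mat" where
  "chol_factor n k K s =
     mat n k (\<lambda>(i, j). let w = col (chol_residual K s j) (s j) in w $ i / sqrt (w $ s j))"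

text \<open>\<open>F\<close> is a possible output; distinct tie-breaking choices give distinct witnesses \<open>s\<close>.\<close>

definition pivoted_cholesky :: "nat \<Rightarrow> nat \<Rightarrow> real mat \<Rightarrow> real mat \<Rightarrow> bool" where
  "pivoted_cholesky n k K F \<longleftrightarrow> (\<exists>s. greedy_pivots n k K s \<and> F = chol_factor n k K s)"

definition thin_svd ::
    "nat \<Rightarrow> nat \<Rightarrow> real mat \<Rightarrow> real mat \<Rightarrow> (nat \<Rightarrow> real) \<Rightarrow> real mat \<Rightarrow> bool" where
  "thin_svd n k F U d V \<longleftrightarrow>
     U \<in> carrier_mat n k \<and> transpose_mat U * U = 1\<^sub>m k \<and>
     V \<in> carrier_mat k k \<and> transpose_mat V * V = 1\<^sub>m k \<and>
     (\<forall>i<k. 0 \<le> d i) \<and> (\<forall>i j. i \<le> j \<longrightarrow> j < k \<longrightarrow> d j \<le> d i) \<and>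
     F = U * mat_diag k d * transpose_mat V"

definition permutation_matrix :: "nat \<Rightarrow> real mat \<Rightarrow> bool" where
  "permutation_matrix n M \<longleftrightarrow>
     (\<exists>p. p permutes {..<n} \<and> M = mat n n (\<lambda>(i, j). if i = p j then 1 else 0))"

definition first_cols :: "nat \<Rightarrow> real mat \<Rightarrow> real mat" where
  "first_cols k M = mat (dim_row M) k (\<lambda>(i, j). M $$ (i, j))"

text \<open>\<open>M\<close> is a permutation matrix that strong rank-revealing QR with parameter \<open>f\<close> may return
  for a full-rank \<open>k \<times> n\<close> matrix \<open>A\<close>, i.e. one meeting the Gu--Eisenstat guarantee.
  Here \<open>R = [R\<^sub>1\<^sub>1 R\<^sub>1\<^sub>2]\<close>.\<close>

definition sRRQR :: "nat \<Rightarrow> nat \<Rightarrow> real \<Rightarrow> real mat \<Rightarrow> real mat \<Rightarrow> bool" where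
  "sRRQR k n f A M \<longleftrightarrow> A \<in> carrier_mat k n \<and> permutation_matrix n M \<and>
     (\<exists>Q R. Q \<in> carrier_mat k k \<and> transpose_mat Q * Q = 1\<^sub>m k \<and>
        R \<in> carrier_mat k n \<and> A * M = Q * R \<and>
        upper_triangular (first_cols k R) \<and> invertible_mat (first_cols k R) \<and>
        (\<forall>i\<in>{1..k}.
           singular_value (first_cols k R) i \<le> singular_value A i \<and>
           singular_value A i / sqrt (1 + f\<^sup>2 * real k * (real n - real k))
             \<le> singular_value (first_cols k R) i))"

definition CholeskyGKS_sRRQR :: "nat \<Rightarrow> nat \<Rightarrow> real \<Rightarrow> real mat \<Rightarrow> real mat \<Rightarrow> bool" where
  "CholeskyGKS_sRRQR n k f K S \<longleftrightarrow>
     (\<exists>F U d V M. pivoted_cholesky n k K F \<and> thin_svd n k F U d V \<and>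
        sRRQR k n f (transpose_mat U) M \<and> S = first_cols k M)"

definition Lambda_mat :: "nat \<Rightarrow> real mat \<Rightarrow> real mat" where
  "Lambda_mat k K = mat_diag k (\<lambda>i. nth_eigenvalue K (Suc i))"

definition c_coeff :: "nat \<Rightarrow> nat \<Rightarrow> real" where
  "c_coeff n i = 1 / (4 ^ (i - 1) * (real n - real i + 1))"

definition C_mat :: "nat \<Rightarrow> nat \<Rightarrow> real mat" where
  "C_mat n k = mat_diag k (\<lambda>i. c_coeff n (Suc i))"

end

theory Submission
  imports Defs
begin

text \<open>The selected block is bounded eigenvalue by eigenvalue. Since
\<open>\<phi>\<^sub>D(S) = \<Sum>\<^sub>i ln (1 + \<lambda>\<^sub>i(S\<^sup>T K S) / \<eta>\<^sup>2)\<close>, and the right-hand side of the claim has the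
same shape, the theorem follows from
\<open>\<lambda>\<^sub>i(S\<^sup>T K S) \<ge> \<lambda>\<^sub>i(K) c\<^sub>i / q\<close> with \<open>q = 1 + f\<^sup>2 k (n - k)\<close>, where \<open>c\<^sub>i\<close>
is the \<open>i\<close>-th diagonal entry of \<open>C\<close>, for each \<open>i \<le> k\<close>
(\<open>CholeskyGKS_eigenvalue_bound\<close>). The proof compares quadratic forms on subspaces cut out
by few linear equations, in the manner of Courant and Fischer, and has two halves that meet
at the singular values \<open>d\<^sub>i\<close> of the Cholesky factor \<open>F\<close>.

Cholesky half (\<open>singular_value_lower_bound\<close>): \<open>d\<^sub>i\<^sup>2 \<ge> \<lambda>\<^sub>i(K) c\<^sub>i\<close>.
Let \<open>p\<close> be the \<open>i\<close>-th pivot. On the orthogonal complement of the first \<open>i - 1\<close> pivot columns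
\<open>K\<close> agrees with the residual, whose trace is at most \<open>(n - i + 1) p\<close>: the pivot is the largest
diagonal entry, and the diagonal vanishes at the \<open>i - 1\<close> earlier pivots. Hence
\<open>\<lambda>\<^sub>i(K) \<le> (n - i + 1) p\<close>. On the other hand, restricted to the first \<open>i\<close> pivot coordinates the
factor is a unit triangular matrix \<open>L\<close> times the square roots of the pivots. Greedy pivoting
keeps all entries of \<open>L\<close> in \<open>[-1, 1]\<close>, so back substitution bounds the inverse of \<open>L\<close> by
\<open>2^(i - 1)\<close>, and pivots never increase. Therefore \<open>F F\<^sup>T\<close> is at least \<open>p / 4^(i - 1)\<close> on an
\<open>i\<close>-dimensional subspace, and so is \<open>d\<^sub>i\<^sup>2\<close>. If \<open>p = 0\<close>, the first bound already makes the claim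
trivial.

Selection half (\<open>compression_eigenvalue_lower_bound\<close>): \<open>\<lambda>\<^sub>i(S\<^sup>T K S) \<ge> d\<^sub>i\<^sup>2 / q\<close>.
The residual is positive semidefinite, so \<open>S\<^sup>T K S\<close> dominates \<open>S\<^sup>T F F\<^sup>T S = G\<^sup>T D\<^sup>2 G\<close> with
\<open>G = U\<^sup>T S = Q R11\<close>. All nonzero singular values of \<open>U\<^sup>T\<close> equal 1, hence the rank-revealing property
gives \<open>|G y|\<^sup>2 \<ge> |y|\<^sup>2 / q\<close>, and on the vectors \<open>y\<close> for which \<open>G y\<close> is supported on the first \<open>i\<close>
coordinates the form is at least \<open>d\<^sub>i\<^sup>2 |y|\<^sup>2 / q\<close>.\<close>

section \<open>Orthonormal eigenbases of real symmetric matrices\<close>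

lemma real_scalar_prod_self:
  fixes x :: "real vec"
  assumes "x \<in> carrier_vec n"
  shows "0 \<le> x \<bullet> x" "x \<bullet> x = 0 \<longleftrightarrow> x = 0\<^sub>v n" "x \<noteq> 0\<^sub>v n \<Longrightarrow> 0 < x \<bullet> x"
proof -
  have *: "x \<bullet> x = (\<Sum>i<n. (x $ i)\<^sup>2)"
    using assms by (auto simp: scalar_prod_def power2_eq_square atLeast0LessThan)
  show 1: "0 \<le> x \<bullet> x" unfolding * by (simp add: sum_nonneg)
  have "x \<bullet> x = 0 \<longleftrightarrow> (\<forall>i<n. x $ i = 0)"
    unfolding * by (subst sum_nonneg_eq_0_iff) auto
  also have "\<dots> \<longleftrightarrow> x = 0\<^sub>v n" using assms by (auto intro!: eq_vecI)
  finally show 2: "x \<bullet> x = 0 \<longleftrightarrow> x = 0\<^sub>v n" .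
  show "x \<noteq> 0\<^sub>v n \<Longrightarrow> 0 < x \<bullet> x" using 1 2 by linarith
qed

lemma scalar_prod_eq_sum:
  assumes "y \<in> carrier_vec n"
  shows "x \<bullet> y = (\<Sum>i<n. x $ i * y $ i)"
  using assms by (simp add: scalar_prod_def atLeast0LessThan)

lemma symmetric_scalar_prod:
  fixes A :: "real mat"
  assumes "A \<in> carrier_mat n n" "transpose_mat A = A" "x \<in> carrier_vec n" "y \<in> carrier_vec n"
  shows "(A *\<^sub>v x) \<bullet> y = x \<bullet> (A *\<^sub>v y)"
  using transpose_vec_mult_scalar[OF assms(1,4,3)] assms(2) by simp

text \<open>Padding the functionals with zero rows gives a square matrix whose last row vanishes, so its
determinant is 0 and it has a kernel. Subspaces are represented by such sets \<open>C\<close> of defining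
equations throughout: intersecting subspaces is then a union of sets, and dimension counting
is a bound on a cardinality.\<close>

lemma nonzero_common_zero:
  fixes C :: "real vec set"
  assumes "finite C" "C \<subseteq> carrier_vec m" "card C < m"
  obtains y where "y \<in> carrier_vec m" "y \<noteq> 0\<^sub>v m" "\<And>c. c \<in> C \<Longrightarrow> c \<bullet> y = 0"
proof -
  obtain cs where cs: "set cs = C" "distinct cs" using finite_distinct_list[OF assms(1)] by blast
  have len: "length cs < m" using cs assms(3) distinct_card by fastforce
  define A where "A = mat_of_rows m (cs @ replicate (m - length cs) (0\<^sub>v m))"
  have A: "A \<in> carrier_mat m m" using len by (auto simp: A_def)
  have row: "row A i = (if i < length cs then cs ! i else 0\<^sub>v m)" if "i < m" for i
    unfolding A_def using that len cs assms(2)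
    by (subst mat_of_rows_row) (auto simp: nth_append)
  have "det A = 0"
  proof -
    have "row A (m - 1) = 0\<^sub>v m" using row[of "m - 1"] len by auto
    hence "\<forall>j<m. A $$ (m - 1, j) = 0" using A len
      by (metis carrier_matD diff_less index_row(1) index_zero_vec(1) less_nat_zero_code less_one linorder_neqE_nat)
    hence "det (transpose_mat A) = 0"
      using laplace_expansion_column[of "transpose_mat A" m "m - 1"] A len
      by (auto intro!: sum.neutral)
    thus ?thesis using det_transpose[OF A] by simp
  qed
  then obtain y where y: "y \<in> carrier_vec m" "y \<noteq> 0\<^sub>v m" "A *\<^sub>v y = 0\<^sub>v m"
    using det_0_iff_vec_prod_zero[OF A] by blast
  show ?thesis
  proof (rule that[OF y(1,2)])
    fix c assume "c \<in> C"
    then obtain i where i: "i < length cs" "c = cs ! i" using cs by (metis in_set_conv_nth)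
    have "(A *\<^sub>v y) $ i = row A i \<bullet> y" using A i len by auto
    thus "c \<bullet> y = 0" using row[of i] i len y(3) by auto
  qed
qed

text \<open>A complex eigenvector \<open>z = x + \<i> y\<close> for \<open>l\<close> exists because the characteristic polynomial has a
root. Comparing \<open>(A x) \<bullet> y\<close> with \<open>x \<bullet> (A y)\<close> gives \<open>Im l (x \<bullet> x + y \<bullet> y) = 0\<close>, so \<open>l\<close> is real and
one of \<open>x\<close>, \<open>y\<close> is a real eigenvector.\<close>

lemma symmetric_real_eigenpair:
  fixes A :: "real mat"
  assumes A: "A \<in> carrier_mat n n" and sym: "transpose_mat A = A" and n: "0 < n"
  obtains x e where "x \<in> carrier_vec n" "x \<noteq> 0\<^sub>v n" "A *\<^sub>v x = e \<cdot>\<^sub>v x"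
proof -
  let ?A = "map_mat complex_of_real A"
  have cA: "?A \<in> carrier_mat n n" using A by simp
  have "degree (char_poly ?A) = n" by (rule degree_monic_char_poly[OF cA, THEN conjunct1])
  hence "\<not> constant (poly (char_poly ?A))" using n by (simp add: constant_degree)
  then obtain l where "poly (char_poly ?A) l = 0"
    using fundamental_theorem_of_algebra by blast
  then obtain z where z: "z \<in> carrier_vec n" "z \<noteq> 0\<^sub>v n" "?A *\<^sub>v z = l \<cdot>\<^sub>v z"
    using eigenvalue_root_char_poly[OF cA] cA unfolding eigenvalue_def eigenvector_def by auto
  define x where "x = map_vec Re z"
  define y where "y = map_vec Im z"
  have xy: "x \<in> carrier_vec n" "y \<in> carrier_vec n" using z by (auto simp: x_def y_def)
  have Ax: "(A *\<^sub>v x) $ i = Re l * x $ i - Im l * y $ i"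
   and Ay: "(A *\<^sub>v y) $ i = Im l * x $ i + Re l * y $ i" if i: "i < n" for i
  proof -
    have e: "(?A *\<^sub>v z) $ i = l * z $ i" using z i by simp
    have s: "l * z $ i = (\<Sum>j<n. complex_of_real (A $$ (i,j)) * z $ j)"
      unfolding e[symmetric] using A z(1) i by (simp add: scalar_prod_eq_sum[of _ n])
    show "(A *\<^sub>v x) $ i = Re l * x $ i - Im l * y $ i"
      using arg_cong[OF s, of Re] A z(1) i xy
      by (auto simp: scalar_prod_eq_sum[of _ n] x_def y_def)
    show "(A *\<^sub>v y) $ i = Im l * x $ i + Re l * y $ i"
      using arg_cong[OF s, of Im] A z(1) i xy
      by (auto simp: scalar_prod_eq_sum[of _ n] x_def y_def)
  qed
  have Axv: "A *\<^sub>v x = Re l \<cdot>\<^sub>v x - Im l \<cdot>\<^sub>v y"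
    using A xy Ax by (intro eq_vecI) auto
  have Ayv: "A *\<^sub>v y = Im l \<cdot>\<^sub>v x + Re l \<cdot>\<^sub>v y"
    using A xy Ay by (intro eq_vecI) auto
  have "(A *\<^sub>v x) \<bullet> y = x \<bullet> (A *\<^sub>v y)" by (rule symmetric_scalar_prod[OF A sym xy])
  hence "Im l * (x \<bullet> x + y \<bullet> y) = 0" unfolding Axv Ayv using xy
    by (simp add: minus_scalar_prod_distrib[of _ n] scalar_prod_add_distrib[of _ n] algebra_simps)
  moreover have "x \<noteq> 0\<^sub>v n \<or> y \<noteq> 0\<^sub>v n"
  proof (rule ccontr)
    assume "\<not> ?thesis"
    hence "z $ i = 0" if "i < n" for i
      using that z xy unfolding x_def y_def
      by (metis complex_eq_iff index_map_vec(1) carrier_vecD index_zero_vec(1) zero_complex.sel(1,2))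
    thus False using z by (auto intro!: eq_vecI)
  qed
  ultimately have "Im l = 0"
    using real_scalar_prod_self[OF xy(1)] real_scalar_prod_self[OF xy(2)]
    by (smt (verit) mult_eq_0_iff)
  hence "A *\<^sub>v x = Re l \<cdot>\<^sub>v x" "A *\<^sub>v y = Re l \<cdot>\<^sub>v y"
    using Axv Ayv xy by (auto intro!: eq_vecI)
  thus ?thesis using that xy \<open>x \<noteq> 0\<^sub>v n \<or> y \<noteq> 0\<^sub>v n\<close> by blast
qed

definition orthonormal :: "nat \<Rightarrow> real vec set \<Rightarrow> bool" where
  "orthonormal n T \<longleftrightarrow> finite T \<and> T \<subseteq> carrier_vec n \<and>
     (\<forall>u\<in>T. \<forall>v\<in>T. u \<bullet> v = (if u = v then 1 else 0))"

lemma orthonormal_insert: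
  assumes T: "orthonormal n T" and x: "x \<in> carrier_vec n" "x \<noteq> 0\<^sub>v n"
    and orth: "\<And>u. u \<in> T \<Longrightarrow> u \<bullet> x = 0"
  shows "orthonormal n (insert ((1 / sqrt (x \<bullet> x)) \<cdot>\<^sub>v x) T)"
    and "(1 / sqrt (x \<bullet> x)) \<cdot>\<^sub>v x \<notin> T"
proof -
  let ?u = "(1 / sqrt (x \<bullet> x)) \<cdot>\<^sub>v x"
  have pos: "0 < x \<bullet> x" by (rule real_scalar_prod_self(3)[OF x])
  have u: "?u \<in> carrier_vec n" using x by simp
  have uu: "?u \<bullet> ?u = 1" using x pos by (simp add: field_simps)
  have ut: "t \<bullet> ?u = 0" "?u \<bullet> t = 0" if "t \<in> T" for t
  proof -
    have t: "t \<in> carrier_vec n" using T that by (auto simp: orthonormal_def)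
    show "t \<bullet> ?u = 0" using orth[OF that] t x by simp
    thus "?u \<bullet> t = 0" using comm_scalar_prod[OF t u] by simp
  qed
  show nin: "?u \<notin> T" using ut uu by fastforce
  show "orthonormal n (insert ?u T)"
    using T u uu ut nin unfolding orthonormal_def by auto
qed

lemma orthonormal_columns:
  assumes T: "orthonormal n T" and us: "set us = T" "distinct us"
  shows "transpose_mat (mat_of_cols n us) * mat_of_cols n us = 1\<^sub>m (length us)"
proof (rule eq_matI)
  fix i j assume "i < dim_row (1\<^sub>m (length us))" "j < dim_col (1\<^sub>m (length us))"
  hence ij: "i < length us" "j < length us" by auto
  have c: "us ! i \<in> carrier_vec n" "us ! j \<in> carrier_vec n"
    using T us ij nth_mem unfolding orthonormal_def by blast+
  have "us ! i \<bullet> us ! j = (if us ! i = us ! j then 1 else 0)"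
    using T us ij nth_mem unfolding orthonormal_def by blast
  thus "(transpose_mat (mat_of_cols n us) * mat_of_cols n us) $$ (i,j) = 1\<^sub>m (length us) $$ (i,j)"
    using ij c nth_eq_iff_index_eq[OF us(2)] by simp
qed auto

text \<open>A square matrix with orthonormal columns has its transpose as a left inverse, hence also as a
right inverse.\<close>

lemma orthonormal_complete:
  assumes T: "orthonormal n T" and card: "card T = n"
    and z: "z \<in> carrier_vec n" and orth: "\<And>u. u \<in> T \<Longrightarrow> u \<bullet> z = 0"
  shows "z = 0\<^sub>v n"
proof -
  obtain us where us: "set us = T" "distinct us"
    using T finite_distinct_list[of T] by (auto simp: orthonormal_def)
  let ?U = "mat_of_cols n us"
  have len: "length us = n" using distinct_card[OF us(2)] us(1) card by simp
  have U: "?U \<in> carrier_mat n n" using len by auto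
  have "transpose_mat ?U * ?U = 1\<^sub>m n" using orthonormal_columns[OF T us] len by simp
  hence UU: "?U * transpose_mat ?U = 1\<^sub>m n"
    using mat_mult_left_right_inverse[of "transpose_mat ?U" n ?U] U by simp
  have "transpose_mat ?U *\<^sub>v z = 0\<^sub>v n"
  proof (rule eq_vecI)
    fix i assume "i < dim_vec (0\<^sub>v n)"
    hence i: "i < length us" using len by simp
    have "us ! i \<in> T" using us i nth_mem by blast
    moreover have "us ! i \<in> carrier_vec n" using T calculation by (auto simp: orthonormal_def)
    ultimately show "(transpose_mat ?U *\<^sub>v z) $ i = 0\<^sub>v n $ i"
      using orth i len by simp
  qed (use len in auto)
  hence "?U *\<^sub>v (transpose_mat ?U *\<^sub>v z) = 0\<^sub>v n" using U by (auto intro!: eq_vecI)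
  moreover have "?U *\<^sub>v (transpose_mat ?U *\<^sub>v z) = z"
    using UU U z assoc_mult_mat_vec[of ?U n n "transpose_mat ?U" n z] by simp
  ultimately show ?thesis by simp
qed

lemma orthonormal_card_le:
  assumes T: "orthonormal n T"
  shows "card T \<le> n"
proof (rule ccontr)
  assume "\<not> card T \<le> n"
  then obtain T' where T': "T' \<subseteq> T" "card T' = n"
    by (metis nat_le_linear obtain_subset_with_card_n)
  have "orthonormal n T'" using T T'(1) unfolding orthonormal_def
    by (meson finite_subset subset_eq)
  obtain t where t: "t \<in> T" "t \<notin> T'" using T' \<open>\<not> card T \<le> n\<close>
    by (metis order_refl subsetI subset_antisym)
  have "t \<in> carrier_vec n" "\<And>u. u \<in> T' \<Longrightarrow> u \<bullet> t = 0" "t \<bullet> t = 1"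
    using T t T'(1) unfolding orthonormal_def by (blast, metis subsetD, simp)
  with orthonormal_complete[OF \<open>orthonormal n T'\<close> T'(2), of t] show False by auto
qed

lemma orthonormal_extend:
  assumes T: "orthonormal n T"
  obtains B where "T \<subseteq> B" "orthonormal n B" "card B = n"
proof -
  have "\<exists>B. T \<subseteq> B \<and> orthonormal n B \<and> card B = n" if "n - card T = k" for k
    using that T
  proof (induction k arbitrary: T)
    case 0
    thus ?case using orthonormal_card_le[of n T] by auto
  next
    case (Suc k)
    have fin: "finite T" "T \<subseteq> carrier_vec n" using Suc.prems by (auto simp: orthonormal_def)
    obtain x where x: "x \<in> carrier_vec n" "x \<noteq> 0\<^sub>v n" "\<And>u. u \<in> T \<Longrightarrow> u \<bullet> x = 0"
      using nonzero_common_zero[OF fin] Suc.prems by (metis zero_less_Suc zero_less_diff)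
    note ins = orthonormal_insert[OF Suc.prems(2) x]
    have "n - card (insert ((1 / sqrt (x \<bullet> x)) \<cdot>\<^sub>v x) T) = k"
      using fin ins(2) Suc.prems(1) by simp
    from Suc.IH[OF this ins(1)] show ?case by blast
  qed
  thus ?thesis using that by blast
qed

text \<open>Extend \<open>T\<close> by columns \<open>Q\<close> to an orthonormal basis and take an eigenvector \<open>y\<close> of the
compression \<open>Q\<^sup>T A Q\<close>. Then \<open>A Q y - e Q y\<close> is orthogonal to the columns of \<open>Q\<close> by choice of \<open>y\<close>
and to \<open>T\<close> because \<open>T\<close> consists of eigenvectors of a symmetric matrix, so it is zero.\<close>

lemma symmetric_eigenvector_orthogonal_to:
  fixes A :: "real mat"
  assumes A: "A \<in> carrier_mat n n" and sym: "transpose_mat A = A"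
    and T: "orthonormal n T" and card: "card T < n"
    and eig: "\<And>u. u \<in> T \<Longrightarrow> \<exists>e. A *\<^sub>v u = e \<cdot>\<^sub>v u"
  obtains x e where "x \<in> carrier_vec n" "x \<noteq> 0\<^sub>v n" "\<And>u. u \<in> T \<Longrightarrow> u \<bullet> x = 0"
    "A *\<^sub>v x = e \<cdot>\<^sub>v x"
proof -
  obtain B where B: "T \<subseteq> B" "orthonormal n B" "card B = n" by (rule orthonormal_extend[OF T])
  have finB: "finite B" "B \<subseteq> carrier_vec n" using B by (auto simp: orthonormal_def)
  obtain qs where qs: "set qs = B - T" "distinct qs"
    using finite_distinct_list[of "B - T"] finB by auto
  have oq: "orthonormal n (B - T)" using B(2) by (auto simp: orthonormal_def)
  define m where "m = length qs"
  have "m = n - card T"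
    using distinct_card[OF qs(2)] qs(1) B finB card_Diff_subset[of T B] finite_subset[OF B(1)]
    by (simp add: m_def)
  hence m: "0 < m" using card by simp
  define Q where "Q = mat_of_cols n qs"
  have Q: "Q \<in> carrier_mat n m" by (simp add: Q_def m_def)
  have QQ: "transpose_mat Q * Q = 1\<^sub>m m"
    using orthonormal_columns[OF oq qs] by (simp add: Q_def m_def)
  let ?C = "transpose_mat Q * (A * Q)"
  have C: "?C \<in> carrier_mat m m" using Q A by simp
  have "transpose_mat ?C = ?C"
    using Q A sym transpose_mult[of "transpose_mat Q" m n "A * Q" m] transpose_mult[OF A Q] by simp
  then obtain y e where y: "y \<in> carrier_vec m" "y \<noteq> 0\<^sub>v m" "?C *\<^sub>v y = e \<cdot>\<^sub>v y"
    using symmetric_real_eigenpair[OF C _ m] by blast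
  define x where "x = Q *\<^sub>v y"
  have x: "x \<in> carrier_vec n" using Q y by (simp add: x_def)
  have QTx: "transpose_mat Q *\<^sub>v x = y"
    using QQ Q y assoc_mult_mat_vec[of "transpose_mat Q" m n Q m y] by (simp add: x_def)
  have x0: "x \<noteq> 0\<^sub>v n"
  proof
    assume "x = 0\<^sub>v n"
    hence "y = 0\<^sub>v m" using QTx Q by (auto intro!: eq_vecI)
    thus False using y by simp
  qed
  have Ty: "t \<bullet> x = 0" if "t \<in> T" for t
  proof -
    have t: "t \<in> carrier_vec n" "t \<in> B" using that B finB by auto
    have "transpose_mat Q *\<^sub>v t = 0\<^sub>v m"
    proof (rule eq_vecI)
      fix i assume "i < dim_vec (0\<^sub>v m)"
      hence i: "i < length qs" by (simp add: m_def)
      have mem: "qs ! i \<in> B - T" using qs i nth_mem by blast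
      hence "qs ! i \<in> carrier_vec n" "qs ! i \<bullet> t = 0"
        using finB t that B(2) unfolding orthonormal_def by auto
      thus "(transpose_mat Q *\<^sub>v t) $ i = 0\<^sub>v m $ i" using i by (simp add: Q_def m_def)
    qed (use Q in auto)
    hence "t \<bullet> (Q *\<^sub>v y) = 0" using transpose_vec_mult_scalar[OF Q y(1) t(1)] y by simp
    thus ?thesis by (simp add: x_def)
  qed
  have Ax: "A *\<^sub>v x \<in> carrier_vec n" using A x by simp
  have "A *\<^sub>v x - e \<cdot>\<^sub>v x = 0\<^sub>v n"
  proof (rule orthonormal_complete[OF B(2,3)])
    show "A *\<^sub>v x - e \<cdot>\<^sub>v x \<in> carrier_vec n" using Ax x by simp
    fix u assume u: "u \<in> B"
    hence uc: "u \<in> carrier_vec n" using finB by auto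
    have "u \<bullet> (A *\<^sub>v x) = e * (u \<bullet> x)"
    proof (cases "u \<in> T")
      case True
      then obtain l where "A *\<^sub>v u = l \<cdot>\<^sub>v u" using eig by blast
      hence "u \<bullet> (A *\<^sub>v x) = l * (u \<bullet> x)"
        using symmetric_scalar_prod[OF A sym uc x] uc x by simp
      thus ?thesis using Ty[OF True] by simp
    next
      case False
      then obtain i where i: "i < m" "u = qs ! i"
        using u qs unfolding m_def by (metis Diff_iff in_set_conv_nth)
      have r: "row (transpose_mat Q) i = u" using i uc by (simp add: Q_def m_def)
      have "?C *\<^sub>v y = transpose_mat Q *\<^sub>v (A *\<^sub>v x)"
        using Q A y assoc_mult_mat_vec[of "transpose_mat Q" m n "A * Q" m y]
          assoc_mult_mat_vec[OF A Q y(1)] by (simp add: x_def)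
      hence "u \<bullet> (A *\<^sub>v x) = (e \<cdot>\<^sub>v y) $ i" using y(3) i r Q
        by (metis carrier_matD(2) index_mult_mat_vec index_transpose_mat(2))
      also have "\<dots> = e * (transpose_mat Q *\<^sub>v x) $ i" using QTx i y by simp
      also have "(transpose_mat Q *\<^sub>v x) $ i = u \<bullet> x" using r i Q by simp
      finally show ?thesis .
    qed
    thus "u \<bullet> (A *\<^sub>v x - e \<cdot>\<^sub>v x) = 0"
      using uc x Ax by (simp add: scalar_prod_minus_distrib[of _ n])
  qed
  hence "(A *\<^sub>v x) $ i - (e \<cdot>\<^sub>v x) $ i = 0" if "i < n" for i
    using that Ax x by (metis carrier_vecD index_minus_vec(1) index_zero_vec(1) smult_carrier_vec)
  hence "A *\<^sub>v x = e \<cdot>\<^sub>v x" using A Ax x by (intro eq_vecI) auto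
  thus ?thesis using that x x0 Ty by blast
qed

lemma symmetric_orthonormal_eigenbasis:
  fixes A :: "real mat"
  assumes A: "A \<in> carrier_mat n n" and sym: "transpose_mat A = A"
  obtains T where "orthonormal n T" "card T = n" "\<And>u. u \<in> T \<Longrightarrow> \<exists>e. A *\<^sub>v u = e \<cdot>\<^sub>v u"
proof -
  have "\<exists>T. orthonormal n T \<and> card T = k \<and> (\<forall>u\<in>T. \<exists>e. A *\<^sub>v u = e \<cdot>\<^sub>v u)" if "k \<le> n" for k
    using that
  proof (induction k)
    case 0
    show ?case by (rule exI[of _ "{}"]) (simp add: orthonormal_def)
  next
    case (Suc k)
    then obtain T where T: "orthonormal n T" "card T = k"
      "\<And>u. u \<in> T \<Longrightarrow> \<exists>e. A *\<^sub>v u = e \<cdot>\<^sub>v u" by auto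
    obtain x e where x: "x \<in> carrier_vec n" "x \<noteq> 0\<^sub>v n" "\<And>u. u \<in> T \<Longrightarrow> u \<bullet> x = 0"
      and e: "A *\<^sub>v x = e \<cdot>\<^sub>v x"
      using symmetric_eigenvector_orthogonal_to[OF A sym T(1) _ T(3)] T(2) Suc.prems
      by (metis Suc_le_eq)
    let ?u = "(1 / sqrt (x \<bullet> x)) \<cdot>\<^sub>v x"
    note ins = orthonormal_insert[OF T(1) x]
    have "A *\<^sub>v ?u = e \<cdot>\<^sub>v ?u" using mult_mat_vec[OF A x(1)] e
      by (simp add: smult_smult_assoc mult.commute)
    moreover have "finite T" using T by (simp add: orthonormal_def)
    ultimately show ?case using ins T(2,3) by (intro exI[of _ "insert ?u T"]) auto
  qed
  from this[of n] show ?thesis using that by blast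
qed

text \<open>An orthonormal eigenbasis, sorted by eigenvalue, diagonalizes \<open>A\<close>; similarity identifies the
diagonal with the roots of the characteristic polynomial, which is how the eigenvalues are
counted.\<close>

lemma symmetric_spectral_decomposition:
  fixes A :: "real mat"
  assumes A: "A \<in> carrier_mat n n" and sym: "transpose_mat A = A"
  obtains U where "U \<in> carrier_mat n n" "transpose_mat U * U = 1\<^sub>m n" "U * transpose_mat U = 1\<^sub>m n"
    "A = U * mat_diag n (\<lambda>i. nth_eigenvalue A (Suc i)) * transpose_mat U"
    "\<And>i j. i \<le> j \<Longrightarrow> j < n \<Longrightarrow> nth_eigenvalue A (Suc j) \<le> nth_eigenvalue A (Suc i)"
proof -
  obtain T where T: "orthonormal n T" "card T = n"
    and eig: "\<And>u. u \<in> T \<Longrightarrow> \<exists>e. A *\<^sub>v u = e \<cdot>\<^sub>v u"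
    using symmetric_orthonormal_eigenbasis[OF A sym] by metis
  have fin: "finite T" "T \<subseteq> carrier_vec n" using T by (auto simp: orthonormal_def)
  define ev where "ev u = u \<bullet> (A *\<^sub>v u)" for u
  have ev: "A *\<^sub>v u = ev u \<cdot>\<^sub>v u" if "u \<in> T" for u
  proof -
    obtain e where e: "A *\<^sub>v u = e \<cdot>\<^sub>v u" using eig[OF \<open>u \<in> T\<close>] by blast
    have "u \<bullet> u = 1" "u \<in> carrier_vec n" using T that fin by (auto simp: orthonormal_def)
    hence "ev u = e" by (simp add: ev_def e)
    thus ?thesis using e by simp
  qed
  obtain us0 where us0: "set us0 = T" "distinct us0" using finite_distinct_list[OF fin(1)] by blast
  \<comment> \<open>negated keys give a non-increasing order of the eigenvalues\<close>
  define us where "us = sort_key (\<lambda>u. - ev u) us0"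
  have us: "set us = T" "distinct us" using us0 by (auto simp: us_def)
  have len: "length us = n" using distinct_card[OF us(2)] us(1) T by simp
  have desc: "sorted (map (\<lambda>u. - ev u) us)" by (simp add: us_def)
  define U where "U = mat_of_cols n us"
  have U: "U \<in> carrier_mat n n" by (simp add: U_def len mat_of_cols_carrier(1)[of n us, unfolded len])
  have UU: "transpose_mat U * U = 1\<^sub>m n"
    using orthonormal_columns[OF T(1) us] by (simp add: U_def len)
  have UU': "U * transpose_mat U = 1\<^sub>m n"
    using mat_mult_left_right_inverse[of "transpose_mat U" n U] U UU by simp
  let ?D = "mat_diag n (\<lambda>i. ev (us ! i))"
  have "A * U = U * ?D"
  proof (rule eq_matI)
    fix i j assume "i < dim_row (U * ?D)" "j < dim_col (U * ?D)"
    hence ij: "i < n" "j < n" using U by (auto simp: mat_diag_def)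
    have mem: "us ! j \<in> T" using us ij len nth_mem by blast
    hence uc: "us ! j \<in> carrier_vec n" using fin by auto
    have cU: "col U j = us ! j" using ij len uc by (simp add: U_def)
    have "(A * U) $$ (i, j) = (A *\<^sub>v (us ! j)) $ i" using A U ij cU by simp
    also have "\<dots> = ev (us ! j) * (us ! j) $ i" using ev[OF mem] uc ij by simp
    also have "(us ! j) $ i = U $$ (i, j)" using cU U ij by (metis carrier_matD index_col)
    finally show "(A * U) $$ (i, j) = (U * ?D) $$ (i, j)"
      using ij by (simp add: mat_diag_mult_right[OF U])
  qed (use A U in \<open>auto simp: mat_diag_def\<close>)
  hence dec: "A = U * ?D * transpose_mat U"
    using assoc_mult_mat[OF A U, of "transpose_mat U" n] U A UU' by simp
  have "similar_mat A ?D"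
    unfolding similar_mat_def similar_mat_wit_def Let_def
    by (rule exI[of _ U], rule exI[of _ "transpose_mat U"]) (use A U UU UU' dec in auto)
  hence "char_poly A = char_poly ?D" by (rule char_poly_similar)
  also have "\<dots> = (\<Prod>a\<leftarrow>diag_mat ?D. [:- a, 1:])"
    by (rule char_poly_upper_triangular[of _ n]) (auto simp: mat_diag_def)
  also have "diag_mat ?D = map ev us"
    using len by (auto simp: diag_mat_def mat_diag_def intro!: nth_equalityI)
  finally have cp: "char_poly A = (\<Prod>a\<leftarrow>map ev us. [:- a, 1:])" .
  have "proots (\<Prod>a\<leftarrow>as. [:- a, 1:]) = mset as" for as :: "real list"
  proof (induction as)
    case (Cons a as)
    have "(\<Prod>a\<leftarrow>as. [:- a, 1:]) \<noteq> 0" by (subst prod_list_zero_iff) auto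
    with Cons show ?case by (simp add: proots_mult del: mult_pCons_left)
  qed simp
  hence "eigenvalues_desc A = rev (sort (map ev us))"
    by (simp only: eigenvalues_desc_def cp sorted_list_of_multiset_mset)
  also have "sort (map ev us) = rev (map ev us)"
  proof (rule properties_for_sort)
    have "sorted_wrt (\<lambda>x y. y \<le> x) (map ev us)" using desc by (simp add: sorted_map sorted_wrt_map)
    thus "sorted (rev (map ev us))" by (simp only: sorted_wrt_rev)
  qed simp
  finally have nth: "nth_eigenvalue A (Suc i) = ev (us ! i)" if "i < n" for i
    using that len by (simp add: nth_eigenvalue_def)
  have D: "?D = mat_diag n (\<lambda>i. nth_eigenvalue A (Suc i))"
    using nth by (auto simp: mat_diag_def)
  show ?thesis
  proof (rule that[OF U UU UU'])
    show "A = U * mat_diag n (\<lambda>i. nth_eigenvalue A (Suc i)) * transpose_mat U"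
      using dec D by simp
    fix i j assume "i \<le> j" "j < n"
    thus "nth_eigenvalue A (Suc j) \<le> nth_eigenvalue A (Suc i)"
      using sorted_nth_mono[OF desc, of i j] len by (simp add: nth)
  qed
qed

section \<open>Quadratic forms and Courant-Fischer bounds\<close>

lemma mat_diag_mult_vec:
  assumes a: "a \<in> carrier_vec k"
  shows "mat_diag k d *\<^sub>v a = vec k (\<lambda>l. d l * a $ l :: real)"
proof (rule eq_vecI)
  fix l assume "l < dim_vec (vec k (\<lambda>l. d l * a $ l))"
  hence l: "l < k" by simp
  have "(mat_diag k d *\<^sub>v a) $ l = (\<Sum>m<k. (if l = m then d m else 0) * a $ m)"
    using l a by (simp add: mat_diag_def scalar_prod_eq_sum[of _ k])
  also have "\<dots> = (\<Sum>m<k. if l = m then d m * a $ m else 0)" by (rule sum.cong) auto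
  also have "\<dots> = d l * a $ l" using l by simp
  finally show "(mat_diag k d *\<^sub>v a) $ l = vec k (\<lambda>l. d l * a $ l) $ l" using l by simp
qed (simp add: mat_diag_def)

lemma gram_form:
  fixes F :: "real mat"
  assumes F: "F \<in> carrier_mat n k" and x: "x \<in> carrier_vec n"
  shows "(transpose_mat F *\<^sub>v x) \<bullet> (transpose_mat F *\<^sub>v x) = (\<Sum>l<k. (col F l \<bullet> x)\<^sup>2)"
  using F x by (subst scalar_prod_eq_sum[of _ k]) (auto simp: power2_eq_square)

lemma diagonalized_form:
  fixes U :: "real mat"
  assumes U: "U \<in> carrier_mat n k" and x: "x \<in> carrier_vec n"
  shows "x \<bullet> ((U * mat_diag k d * transpose_mat U) *\<^sub>v x) = (\<Sum>l<k. d l * (col U l \<bullet> x)\<^sup>2)"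
proof -
  let ?a = "transpose_mat U *\<^sub>v x"
  have a: "?a \<in> carrier_vec k" using U x by simp
  have Da: "mat_diag k d *\<^sub>v ?a \<in> carrier_vec k" using a by (rule mult_mat_vec_carrier[OF mat_diag_dim])
  have "(U * mat_diag k d * transpose_mat U) *\<^sub>v x = U *\<^sub>v (mat_diag k d *\<^sub>v ?a)"
    using U x a assoc_mult_mat_vec[of "U * mat_diag k d" n k "transpose_mat U" n x]
      assoc_mult_mat_vec[OF U mat_diag_dim a] by simp
  hence "x \<bullet> ((U * mat_diag k d * transpose_mat U) *\<^sub>v x) = ?a \<bullet> (mat_diag k d *\<^sub>v ?a)"
    using transpose_vec_mult_scalar[OF U Da x] by simp
  also have "\<dots> = (\<Sum>l<k. d l * (col U l \<bullet> x)\<^sup>2)"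
    using U x unfolding mat_diag_mult_vec[OF a]
    by (subst scalar_prod_eq_sum[of _ k]) (auto simp: power2_eq_square ac_simps)
  finally show ?thesis .
qed

lemma isometry_scalar_prod:
  fixes U :: "real mat"
  assumes U: "U \<in> carrier_mat n k" and UU: "transpose_mat U * U = 1\<^sub>m k" and y: "y \<in> carrier_vec k"
  shows "(U *\<^sub>v y) \<bullet> (U *\<^sub>v y) = y \<bullet> y"
proof -
  have Uy: "U *\<^sub>v y \<in> carrier_vec n" using U y by simp
  have "transpose_mat U *\<^sub>v (U *\<^sub>v y) = y"
    using assoc_mult_mat_vec[of "transpose_mat U" k n U k y] U UU y by simp
  thus ?thesis using transpose_vec_mult_scalar[OF U y Uy] by simp
qed

text \<open>With \<open>y = U U\<^sup>T x\<close>, the inequality is \<open>0 \<le> |x - y|\<^sup>2\<close>.\<close>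

lemma bessel_inequality:
  fixes U :: "real mat"
  assumes U: "U \<in> carrier_mat n k" and UU: "transpose_mat U * U = 1\<^sub>m k" and x: "x \<in> carrier_vec n"
  shows "(\<Sum>l<k. (col U l \<bullet> x)\<^sup>2) \<le> x \<bullet> x"
proof -
  let ?a = "transpose_mat U *\<^sub>v x"
  let ?y = "U *\<^sub>v ?a"
  have a: "?a \<in> carrier_vec k" using U x by simp
  have y: "?y \<in> carrier_vec n" using U a by simp
  have yy: "?y \<bullet> ?y = ?a \<bullet> ?a" by (rule isometry_scalar_prod[OF U UU a])
  have xy: "x \<bullet> ?y = ?a \<bullet> ?a" using transpose_vec_mult_scalar[OF U a x] by simp
  have "0 \<le> (x - ?y) \<bullet> (x - ?y)" using x y by (intro real_scalar_prod_self(1)[of _ n]) simp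
  also have "\<dots> = x \<bullet> x - 2 * (x \<bullet> ?y) + ?y \<bullet> ?y"
    using x y by (simp add: minus_scalar_prod_distrib[of _ n] scalar_prod_minus_distrib[of _ n]
        comm_scalar_prod[OF y x])
  finally show ?thesis using yy xy gram_form[OF U x] by simp
qed

lemma parseval_identity:
  fixes U :: "real mat"
  assumes U: "U \<in> carrier_mat n n" and UU: "U * transpose_mat U = 1\<^sub>m n" and x: "x \<in> carrier_vec n"
  shows "(\<Sum>l<n. (col U l \<bullet> x)\<^sup>2) = x \<bullet> x"
  using gram_form[OF U x] isometry_scalar_prod[of "transpose_mat U" n n x] U UU x by simp

text \<open>Orthogonality to \<open>C\<close> and to the first \<open>j\<close> columns of \<open>U\<close> amounts to fewer than \<open>n\<close> equations, so
some nonzero \<open>x\<close> satisfies them all. The form is at most \<open>d j |x|\<^sup>2\<close> there, as only the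
coefficients from \<open>d j\<close> on occur. The matrix \<open>U\<close> may be rectangular so that the bound applies
to singular values in a thin decomposition; this is why \<open>d j\<close> has to be nonnegative.\<close>

lemma courant_fischer_lower:
  fixes U :: "real mat"
  assumes U: "U \<in> carrier_mat n k" and UU: "transpose_mat U * U = 1\<^sub>m k"
    and anti: "\<And>i j. i \<le> j \<Longrightarrow> j < k \<Longrightarrow> d j \<le> d i" and nonneg: "0 \<le> d j" and j: "j < k"
    and C: "finite C" "C \<subseteq> carrier_vec n" "card C + j < n"
    and form: "\<And>x. x \<in> carrier_vec n \<Longrightarrow> (\<And>c. c \<in> C \<Longrightarrow> c \<bullet> x = 0) \<Longrightarrow>
      \<mu> * (x \<bullet> x) \<le> (\<Sum>l<k. d l * (col U l \<bullet> x)\<^sup>2)"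
  shows "\<mu> \<le> d j"
proof -
  have "card (C \<union> col U ` {..<j}) \<le> card C + j"
    by (rule order.trans[OF card_Un_le]) (use card_image_le[of "{..<j}" "col U"] in auto)
  hence "card (C \<union> col U ` {..<j}) < n" using C by simp
  moreover have "C \<union> col U ` {..<j} \<subseteq> carrier_vec n" using C U by auto
  ultimately obtain x where x: "x \<in> carrier_vec n" "x \<noteq> 0\<^sub>v n"
    and orth: "\<And>c. c \<in> C \<union> col U ` {..<j} \<Longrightarrow> c \<bullet> x = 0"
    using nonzero_common_zero[of "C \<union> col U ` {..<j}" n] C(1) by auto
  have "\<mu> * (x \<bullet> x) \<le> (\<Sum>l<k. d l * (col U l \<bullet> x)\<^sup>2)" using form x orth by blast
  also have "\<dots> \<le> (\<Sum>l<k. d j * (col U l \<bullet> x)\<^sup>2)"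
  proof (rule sum_mono)
    fix l assume "l \<in> {..<k}"
    thus "d l * (col U l \<bullet> x)\<^sup>2 \<le> d j * (col U l \<bullet> x)\<^sup>2"
      using orth[of "col U l"] anti[of j l] by (cases "l < j") (auto intro!: mult_right_mono)
  qed
  also have "\<dots> \<le> d j * (x \<bullet> x)"
    unfolding sum_distrib_left[symmetric]
    by (rule mult_left_mono[OF bessel_inequality[OF U UU x(1)] nonneg])
  finally show ?thesis using real_scalar_prod_self(3)[OF x] by simp
qed

text \<open>Dual to the lower bound: the test vector is now orthogonal to all columns of \<open>U\<close> after
column \<open>j\<close>.\<close>

lemma courant_fischer_upper:
  fixes U :: "real mat"
  assumes U: "U \<in> carrier_mat n n" and UU: "U * transpose_mat U = 1\<^sub>m n"
    and anti: "\<And>i j. i \<le> j \<Longrightarrow> j < n \<Longrightarrow> d j \<le> d i" and j: "j < n"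
    and C: "finite C" "C \<subseteq> carrier_vec n" "card C \<le> j"
    and form: "\<And>x. x \<in> carrier_vec n \<Longrightarrow> (\<And>c. c \<in> C \<Longrightarrow> c \<bullet> x = 0) \<Longrightarrow>
      (\<Sum>l<n. d l * (col U l \<bullet> x)\<^sup>2) \<le> \<nu> * (x \<bullet> x)"
  shows "d j \<le> \<nu>"
proof -
  have "card (C \<union> col U ` {j<..<n}) \<le> card C + (n - Suc j)"
    by (rule order.trans[OF card_Un_le]) (use card_image_le[of "{j<..<n}" "col U"] in auto)
  hence "card (C \<union> col U ` {j<..<n}) < n" using C j by simp
  moreover have "C \<union> col U ` {j<..<n} \<subseteq> carrier_vec n" using C U by auto
  ultimately obtain x where x: "x \<in> carrier_vec n" "x \<noteq> 0\<^sub>v n"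
    and orth: "\<And>c. c \<in> C \<union> col U ` {j<..<n} \<Longrightarrow> c \<bullet> x = 0"
    using nonzero_common_zero[of "C \<union> col U ` {j<..<n}" n] C(1) by auto
  have "d j * (x \<bullet> x) = (\<Sum>l<n. d j * (col U l \<bullet> x)\<^sup>2)"
    by (simp add: sum_distrib_left[symmetric] parseval_identity[OF U UU x(1)])
  also have "\<dots> \<le> (\<Sum>l<n. d l * (col U l \<bullet> x)\<^sup>2)"
  proof (rule sum_mono)
    fix l assume "l \<in> {..<n}"
    thus "d j * (col U l \<bullet> x)\<^sup>2 \<le> d l * (col U l \<bullet> x)\<^sup>2"
      using orth[of "col U l"] anti[of l j] j by (cases "l \<le> j") (auto intro!: mult_right_mono)
  qed
  also have "\<dots> \<le> \<nu> * (x \<bullet> x)" using form x orth by blast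
  finally show ?thesis using real_scalar_prod_self(3)[OF x] by simp
qed

lemma psd_eigenvalue_nonneg:
  assumes psd: "psd_mat n K" and i: "i < n"
  shows "0 \<le> nth_eigenvalue K (Suc i)"
proof -
  have K: "K \<in> carrier_mat n n" "transpose_mat K = K" using psd by (auto simp: psd_mat_def)
  obtain U where U: "U \<in> carrier_mat n n" "transpose_mat U * U = 1\<^sub>m n"
    and dec: "K = U * mat_diag n (\<lambda>i. nth_eigenvalue K (Suc i)) * transpose_mat U"
    using symmetric_spectral_decomposition[OF K] by metis
  have c: "col U i \<in> carrier_vec n" using U i by simp
  have "col U l \<bullet> col U i = (if l = i then 1 else 0)" if "l < n" for l
    using arg_cong[OF U(2), of "\<lambda>M. M $$ (l, i)"] U(1) i that by simp
  hence "(\<Sum>l<n. nth_eigenvalue K (Suc l) * (col U l \<bullet> col U i)\<^sup>2)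
      = (\<Sum>l<n. if l = i then nth_eigenvalue K (Suc l) else 0)"
    by (intro sum.cong) auto
  hence "col U i \<bullet> (K *\<^sub>v col U i) = nth_eigenvalue K (Suc i)"
    using diagonalized_form[OF U(1) c, of "\<lambda>i. nth_eigenvalue K (Suc i)", folded dec] i by simp
  thus ?thesis using psd c by (auto simp: psd_mat_def)
qed

lemma eigenvalue_lower_bound:
  assumes psd: "psd_mat n A" and j: "j < n"
    and C: "finite C" "C \<subseteq> carrier_vec n" "card C + j < n"
    and form: "\<And>x. x \<in> carrier_vec n \<Longrightarrow> (\<And>c. c \<in> C \<Longrightarrow> c \<bullet> x = 0) \<Longrightarrow>
      \<mu> * (x \<bullet> x) \<le> x \<bullet> (A *\<^sub>v x)"
  shows "\<mu> \<le> nth_eigenvalue A (Suc j)"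
proof -
  have A: "A \<in> carrier_mat n n" "transpose_mat A = A" using psd by (auto simp: psd_mat_def)
  obtain U where U: "U \<in> carrier_mat n n" "transpose_mat U * U = 1\<^sub>m n"
    and dec: "A = U * mat_diag n (\<lambda>i. nth_eigenvalue A (Suc i)) * transpose_mat U"
    and anti: "\<And>i j. i \<le> j \<Longrightarrow> j < n \<Longrightarrow> nth_eigenvalue A (Suc j) \<le> nth_eigenvalue A (Suc i)"
    using symmetric_spectral_decomposition[OF A] by metis
  show ?thesis
    using courant_fischer_lower[where d = "\<lambda>i. nth_eigenvalue A (Suc i)", OF U anti psd_eigenvalue_nonneg[OF psd j] j C] form
      diagonalized_form[OF U(1), of _ "\<lambda>i. nth_eigenvalue A (Suc i)", folded dec] by simp
qed

lemma eigenvalue_upper_bound: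
  assumes A: "A \<in> carrier_mat n n" "transpose_mat A = A" and j: "j < n"
    and C: "finite C" "C \<subseteq> carrier_vec n" "card C \<le> j"
    and form: "\<And>x. x \<in> carrier_vec n \<Longrightarrow> (\<And>c. c \<in> C \<Longrightarrow> c \<bullet> x = 0) \<Longrightarrow>
      x \<bullet> (A *\<^sub>v x) \<le> \<nu> * (x \<bullet> x)"
  shows "nth_eigenvalue A (Suc j) \<le> \<nu>"
proof -
  obtain U where U: "U \<in> carrier_mat n n" "U * transpose_mat U = 1\<^sub>m n"
    and dec: "A = U * mat_diag n (\<lambda>i. nth_eigenvalue A (Suc i)) * transpose_mat U"
    and anti: "\<And>i j. i \<le> j \<Longrightarrow> j < n \<Longrightarrow> nth_eigenvalue A (Suc j) \<le> nth_eigenvalue A (Suc i)"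
    using symmetric_spectral_decomposition[OF A] by metis
  show ?thesis
    using courant_fischer_upper[where d = "\<lambda>i. nth_eigenvalue A (Suc i)", OF U anti j C] form
      diagonalized_form[OF U(1), of _ "\<lambda>i. nth_eigenvalue A (Suc i)", folded dec] by simp
qed

lemma least_eigenvalue_form:
  assumes A: "A \<in> carrier_mat n n" "transpose_mat A = A" and n: "0 < n" and x: "x \<in> carrier_vec n"
  shows "nth_eigenvalue A n * (x \<bullet> x) \<le> x \<bullet> (A *\<^sub>v x)"
proof -
  obtain U where U: "U \<in> carrier_mat n n" "U * transpose_mat U = 1\<^sub>m n"
    and dec: "A = U * mat_diag n (\<lambda>i. nth_eigenvalue A (Suc i)) * transpose_mat U"
    and anti: "\<And>i j. i \<le> j \<Longrightarrow> j < n \<Longrightarrow> nth_eigenvalue A (Suc j) \<le> nth_eigenvalue A (Suc i)"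
    using symmetric_spectral_decomposition[OF A] by metis
  have "nth_eigenvalue A n * (x \<bullet> x) = (\<Sum>l<n. nth_eigenvalue A n * (col U l \<bullet> x)\<^sup>2)"
    by (simp add: sum_distrib_left[symmetric] parseval_identity[OF U x])
  also have "\<dots> \<le> (\<Sum>l<n. nth_eigenvalue A (Suc l) * (col U l \<bullet> x)\<^sup>2)"
    using anti[of _ "n - 1"] n by (intro sum_mono mult_right_mono) auto
  also have "\<dots> = x \<bullet> (A *\<^sub>v x)"
    using diagonalized_form[OF U(1) x, of "\<lambda>i. nth_eigenvalue A (Suc i)", folded dec] by simp
  finally show ?thesis .
qed

lemma det_identity_plus_symmetric:
  fixes A :: "real mat"
  assumes A: "A \<in> carrier_mat n n" "transpose_mat A = A"
  shows "det (c \<cdot>\<^sub>m A + 1\<^sub>m n) = (\<Prod>i<n. 1 + c * nth_eigenvalue A (Suc i))"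
proof -
  obtain U where U: "U \<in> carrier_mat n n" "transpose_mat U * U = 1\<^sub>m n" "U * transpose_mat U = 1\<^sub>m n"
    and dec: "A = U * mat_diag n (\<lambda>i. nth_eigenvalue A (Suc i)) * transpose_mat U"
    using symmetric_spectral_decomposition[OF A] by metis
  let ?D = "mat_diag n (\<lambda>i. nth_eigenvalue A (Suc i))"
  let ?E = "mat_diag n (\<lambda>i. 1 + c * nth_eigenvalue A (Suc i))"
  have E: "?E = c \<cdot>\<^sub>m ?D + 1\<^sub>m n" by (rule eq_matI) (auto simp: mat_diag_def)
  have "U * ?E = c \<cdot>\<^sub>m (U * ?D) + U"
    unfolding E using U(1) mult_add_distrib_mat[OF U(1), of "c \<cdot>\<^sub>m ?D" n "1\<^sub>m n"]
      mult_smult_distrib[OF U(1) mat_diag_dim] by simp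
  hence "U * ?E * transpose_mat U = c \<cdot>\<^sub>m (U * ?D * transpose_mat U) + U * transpose_mat U"
    using U(1) add_mult_distrib_mat[of "c \<cdot>\<^sub>m (U * ?D)" n n U "transpose_mat U" n]
      mult_smult_assoc_mat[of "U * ?D" n n "transpose_mat U" n c] mult_carrier_mat[OF U(1) mat_diag_dim]
    by simp
  hence "c \<cdot>\<^sub>m A + 1\<^sub>m n = U * ?E * transpose_mat U" using dec U(3) by simp
  hence "det (c \<cdot>\<^sub>m A + 1\<^sub>m n) = det U * det ?E * det (transpose_mat U)"
    using U(1) det_mult[OF U(1) mat_diag_dim] det_mult[of "U * ?E" n "transpose_mat U"]
      mult_carrier_mat[OF U(1) mat_diag_dim] by simp
  also have "\<dots> = det ?E"
    using det_mult[of U n "transpose_mat U"] U(1,3) by (simp add: mult.commute mult.left_commute)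
  also have "\<dots> = (\<Prod>i<n. 1 + c * nth_eigenvalue A (Suc i))"
    by (subst det_upper_triangular[of _ n])
       (auto simp: prod_list_diag_prod mat_diag_def atLeast0LessThan)
  finally show ?thesis .
qed

section \<open>One Cholesky step on a positive semidefinite matrix\<close>

lemma psd_matD:
  assumes "psd_mat n A"
  shows "A \<in> carrier_mat n n" "transpose_mat A = A" "x \<in> carrier_vec n \<Longrightarrow> 0 \<le> x \<bullet> (A *\<^sub>v x)"
  using assms by (auto simp: psd_mat_def)

lemma symmetric_entry:
  assumes "A \<in> carrier_mat n n" "transpose_mat A = A" "i < n" "j < n"
  shows "A $$ (i, j) = A $$ (j, i)"
  using assms by (metis carrier_matD index_transpose_mat(1))

text \<open>The polynomial \<open>t \<mapsto> (x + t y) \<bullet> A (x + t y)\<close> is nonnegative, so its discriminant is not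
positive. If \<open>y \<bullet> A y = 0\<close> the polynomial is affine and its slope must vanish.\<close>

lemma psd_cauchy_schwarz:
  assumes psd: "psd_mat n A" and x: "x \<in> carrier_vec n" and y: "y \<in> carrier_vec n"
  shows "(x \<bullet> (A *\<^sub>v y))\<^sup>2 \<le> (x \<bullet> (A *\<^sub>v x)) * (y \<bullet> (A *\<^sub>v y))"
proof -
  note A = psd_matD(1,2)[OF psd]
  define a b c where "a = x \<bullet> (A *\<^sub>v x)" and "b = x \<bullet> (A *\<^sub>v y)" and "c = y \<bullet> (A *\<^sub>v y)"
  have Ax: "A *\<^sub>v x \<in> carrier_vec n" "A *\<^sub>v y \<in> carrier_vec n" using A x y by auto
  have b': "y \<bullet> (A *\<^sub>v x) = b"
    using symmetric_scalar_prod[OF A x y] comm_scalar_prod[OF Ax(1) y] by (simp add: b_def)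
  have q: "0 \<le> a + 2 * t * b + t\<^sup>2 * c" for t
  proof -
    have "0 \<le> (x + t \<cdot>\<^sub>v y) \<bullet> (A *\<^sub>v (x + t \<cdot>\<^sub>v y))" using psd_matD(3)[OF psd] x y by simp
    also have "A *\<^sub>v (x + t \<cdot>\<^sub>v y) = A *\<^sub>v x + t \<cdot>\<^sub>v (A *\<^sub>v y)"
      using A x y by (simp add: mult_add_distrib_mat_vec[of _ n n] mult_mat_vec[of _ n n])
    also have "(x + t \<cdot>\<^sub>v y) \<bullet> (A *\<^sub>v x + t \<cdot>\<^sub>v (A *\<^sub>v y)) = a + 2 * t * b + t\<^sup>2 * c"
      using x y Ax b' by (simp add: add_scalar_prod_distrib[of _ n] scalar_prod_add_distrib[of _ n]
          a_def b_def c_def power2_eq_square algebra_simps)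
    finally show ?thesis .
  qed
  have c0: "0 \<le> c" using psd_matD(3)[OF psd y] by (simp add: c_def)
  have "b\<^sup>2 \<le> a * c"
  proof (cases "c = 0")
    case True
    have "b = 0"
    proof (rule ccontr)
      assume "b \<noteq> 0"
      with q[of "- (a + 1) / (2 * b)"] True show False by (simp add: field_simps)
    qed
    thus ?thesis using True by simp
  next
    case False
    hence "0 < c" using c0 by simp
    have "0 \<le> c * (a + 2 * (- b / c) * b + (- b / c)\<^sup>2 * c)" using q[of "- b / c"] c0 by simp
    also have "\<dots> = a * c - b\<^sup>2" using \<open>0 < c\<close> by (simp add: field_simps power2_eq_square)
    finally show ?thesis by simp
  qed
  thus ?thesis by (simp add: a_def b_def c_def)
qed

lemma unit_vec_form:
  assumes "A \<in> carrier_mat n n" "i < n" "j < n"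
  shows "unit_vec n i \<bullet> (A *\<^sub>v unit_vec n j) = (A $$ (i, j) :: real)"
  using assms by (simp add: scalar_prod_left_unit[of _ n])

lemma psd_diag_nonneg:
  assumes "psd_mat n A" "i < n"
  shows "0 \<le> A $$ (i, i)"
  using psd_matD(3)[OF assms(1), of "unit_vec n i"] unit_vec_form[OF psd_matD(1)[OF assms(1)] assms(2,2)]
  by simp

lemma psd_entry_square_le:
  assumes "psd_mat n A" "i < n" "j < n"
  shows "(A $$ (i, j))\<^sup>2 \<le> A $$ (i, i) * A $$ (j, j)"
  using psd_cauchy_schwarz[OF assms(1), of "unit_vec n i" "unit_vec n j"]
  by (simp add: unit_vec_form[OF psd_matD(1)[OF assms(1)]] assms(2,3))

lemma four_mult_le_power2_sum: "4 * p * q \<le> (p + q)\<^sup>2" for p q :: real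
  using zero_le_power2[of "p - q"] by (simp add: power2_sum power2_diff)

text \<open>Each entry satisfies \<open>A\<^sub>i\<^sub>j\<^sup>2 \<le> A\<^sub>i\<^sub>i A\<^sub>j\<^sub>j\<close>, so by the inequality of arithmetic and geometric means
\<open>2 x\<^sub>i A\<^sub>i\<^sub>j x\<^sub>j \<le> x\<^sub>i\<^sup>2 A\<^sub>j\<^sub>j + x\<^sub>j\<^sup>2 A\<^sub>i\<^sub>i\<close>, and the double sum of the right-hand side factorizes.\<close>

lemma psd_form_le_trace:
  assumes psd: "psd_mat n A" and x: "x \<in> carrier_vec n"
  shows "x \<bullet> (A *\<^sub>v x) \<le> (\<Sum>i<n. A $$ (i, i)) * (x \<bullet> x)"
proof -
  note A = psd_matD(1,2)[OF psd]
  have "x \<bullet> (A *\<^sub>v x) = (\<Sum>i<n. \<Sum>j<n. x $ i * (A $$ (i, j) * x $ j))"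
    using A x by (subst scalar_prod_eq_sum[of _ n])
      (auto simp: scalar_prod_eq_sum[of _ n] sum_distrib_left)
  also have "\<dots> \<le> (\<Sum>i<n. \<Sum>j<n. ((x $ i)\<^sup>2 * A $$ (j, j) + (x $ j)\<^sup>2 * A $$ (i, i)) / 2)"
  proof (intro sum_mono)
    fix i j assume "i \<in> {..<n}" "j \<in> {..<n}"
    hence ij: "i < n" "j < n" by auto
    define p q where "p = (x $ i)\<^sup>2 * A $$ (j, j)" and "q = (x $ j)\<^sup>2 * A $$ (i, i)"
    have pq: "0 \<le> p" "0 \<le> q" using psd_diag_nonneg[OF psd] ij by (auto simp: p_def q_def)
    have "(2 * (x $ i * (A $$ (i, j) * x $ j)))\<^sup>2 = 4 * ((x $ i)\<^sup>2 * (x $ j)\<^sup>2) * (A $$ (i, j))\<^sup>2"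
      by (simp add: power_mult_distrib)
    also have "\<dots> \<le> 4 * ((x $ i)\<^sup>2 * (x $ j)\<^sup>2) * (A $$ (i, i) * A $$ (j, j))"
      by (rule mult_left_mono[OF psd_entry_square_le[OF psd ij]]) simp
    also have "\<dots> = 4 * p * q" by (simp add: p_def q_def)
    also have "\<dots> \<le> (p + q)\<^sup>2" by (rule four_mult_le_power2_sum)
    finally have "2 * (x $ i * (A $$ (i, j) * x $ j)) \<le> p + q"
      by (rule power2_le_imp_le) (use pq in simp)
    thus "x $ i * (A $$ (i, j) * x $ j) \<le> (p + q) / 2" by simp
  qed
  also have "\<dots> = ((\<Sum>i<n. \<Sum>j<n. (x $ i)\<^sup>2 * A $$ (j, j)) + (\<Sum>i<n. \<Sum>j<n. (x $ j)\<^sup>2 * A $$ (i, i))) / 2"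
    by (simp only: sum_divide_distrib[symmetric] sum.distrib)
  also have "(\<Sum>i<n. \<Sum>j<n. (x $ j)\<^sup>2 * A $$ (i, i)) = (\<Sum>i<n. \<Sum>j<n. (x $ i)\<^sup>2 * A $$ (j, j))"
    by (rule sum.swap)
  also have "(\<Sum>i<n. \<Sum>j<n. (x $ i)\<^sup>2 * A $$ (j, j)) = (\<Sum>i<n. (x $ i)\<^sup>2) * (\<Sum>i<n. A $$ (i, i))"
    by (rule sum_product[symmetric])
  also have "(\<Sum>i<n. (x $ i)\<^sup>2) = x \<bullet> x"
    using x by (simp add: scalar_prod_eq_sum[of _ n] power2_eq_square)
  finally show ?thesis by (simp add: mult.commute)
qed

lemma outer_prod_form:
  assumes w: "w \<in> carrier_vec n" and x: "x \<in> carrier_vec n"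
  shows "x \<bullet> (outer_prod w *\<^sub>v x) = (w \<bullet> x)\<^sup>2"
proof -
  have "outer_prod w *\<^sub>v x = (w \<bullet> x) \<cdot>\<^sub>v w"
    using w x by (intro eq_vecI)
      (auto simp: outer_prod_def scalar_prod_eq_sum[of _ n] sum_distrib_left ac_simps)
  thus ?thesis using w x comm_scalar_prod[OF x w] by (simp add: power2_eq_square)
qed

lemma rank_one_downdate_form:
  assumes A: "A \<in> carrier_mat n n" and w: "w \<in> carrier_vec n" and x: "x \<in> carrier_vec n"
  shows "x \<bullet> ((A - c \<cdot>\<^sub>m outer_prod w) *\<^sub>v x) = x \<bullet> (A *\<^sub>v x) - c * (w \<bullet> x)\<^sup>2"
proof -
  have o: "outer_prod w \<in> carrier_mat n n" using w by (simp add: outer_prod_def)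
  have "(c \<cdot>\<^sub>m outer_prod w) *\<^sub>v x = c \<cdot>\<^sub>v (outer_prod w *\<^sub>v x)"
    using o x by (intro eq_vecI) auto
  hence "(A - c \<cdot>\<^sub>m outer_prod w) *\<^sub>v x = A *\<^sub>v x - c \<cdot>\<^sub>v (outer_prod w *\<^sub>v x)"
    using A o x by (simp add: minus_mult_distrib_mat_vec[of _ n n])
  thus ?thesis using A o x outer_prod_form[OF w x]
    by (simp add: scalar_prod_minus_distrib[of _ n])
qed

text \<open>The Cauchy-Schwarz inequality for the form of \<open>A\<close> and the unit vector of \<open>t\<close> bounds
exactly the subtracted term. A zero pivot is covered: then \<open>1 / 0 = 0\<close> and nothing is
subtracted.\<close>

lemma psd_cholesky_step:
  assumes psd: "psd_mat n A" and t: "t < n"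
  shows "psd_mat n (A - (1 / A $$ (t, t)) \<cdot>\<^sub>m outer_prod (col A t))"
  unfolding psd_mat_def
proof (intro conjI ballI)
  note A = psd_matD(1,2)[OF psd]
  let ?w = "col A t"
  have w: "?w \<in> carrier_vec n" using A t by simp
  show "A - (1 / A $$ (t, t)) \<cdot>\<^sub>m outer_prod ?w \<in> carrier_mat n n"
    using A by (auto simp: outer_prod_def)
  show "transpose_mat (A - (1 / A $$ (t, t)) \<cdot>\<^sub>m outer_prod ?w) = A - (1 / A $$ (t, t)) \<cdot>\<^sub>m outer_prod ?w"
    using A symmetric_entry[OF A] by (intro eq_matI) (auto simp: outer_prod_def)
  fix x :: "real vec" assume x: "x \<in> carrier_vec n"
  have "?w = A *\<^sub>v unit_vec n t" using A t by (intro eq_vecI) auto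
  hence "?w \<bullet> x = unit_vec n t \<bullet> (A *\<^sub>v x)" using symmetric_scalar_prod[OF A, of "unit_vec n t" x] x by simp
  hence "(?w \<bullet> x)\<^sup>2 \<le> A $$ (t, t) * (x \<bullet> (A *\<^sub>v x))"
    using psd_cauchy_schwarz[OF psd, of "unit_vec n t" x] x unit_vec_form[OF A(1) t t] by simp
  hence "1 / A $$ (t, t) * (?w \<bullet> x)\<^sup>2 \<le> x \<bullet> (A *\<^sub>v x)"
    using psd_diag_nonneg[OF psd t] psd_matD(3)[OF psd x]
    by (cases "A $$ (t, t) = 0") (auto simp: field_simps)
  thus "0 \<le> x \<bullet> ((A - (1 / A $$ (t, t)) \<cdot>\<^sub>m outer_prod ?w) *\<^sub>v x)"
    using rank_one_downdate_form[OF A(1) w x] by simp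
qed

section \<open>Back substitution in unit triangular systems with bounded entries\<close>

lemma sum_one_plus_quarter_powers: "(\<Sum>l\<le>j. 1 + (4 ^ l - 1) / 3 :: real) \<le> 4 ^ j"
proof (induction j)
  case 0
  show ?case by simp
next
  case (Suc j)
  have "1 + (4 * x - 1) / 3 \<le> 3 * x" if "1 \<le> x" for x :: real
    using that by (simp add: field_simps)
  from this[of "4 ^ j", OF one_le_power[OF one_le_numeral]]
  have "1 + (4 ^ Suc j - 1) / 3 \<le> 3 * (4 ^ j :: real)" unfolding power_Suc .
  from add_mono[OF Suc this] show ?case unfolding sum.atMost_Suc power_Suc by linarith
qed

text \<open>Let \<open>S l\<close> and \<open>B l\<close> be the sums of the first \<open>l\<close> terms of \<open>a\<close> and of \<open>b\<^sup>2\<close>. The recurrence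
\<open>S (l + 1) \<le> b l + 2 S l\<close> gives \<open>(S l)\<^sup>2 \<le> c l * B l\<close> for the solution \<open>c l = (4^l - 1) / 3\<close> of
\<open>c (l + 1) = 1 + 4 c l\<close>, \<open>c 0 = 0\<close>. Then \<open>(a l)\<^sup>2 \<le> (1 + c l) * B (l + 1)\<close>, and the factors
\<open>1 + c l\<close> for \<open>l \<le> j\<close> add up to at most \<open>4^j\<close>.\<close>

lemma sum_squares_triangular_recurrence:
  fixes a b :: "nat \<Rightarrow> real"
  assumes a: "\<And>l. l \<le> j \<Longrightarrow> 0 \<le> a l" and b: "\<And>l. l \<le> j \<Longrightarrow> 0 \<le> b l"
    and rec: "\<And>l. l \<le> j \<Longrightarrow> a l \<le> b l + (\<Sum>m<l. a m)"
  shows "(\<Sum>l\<le>j. (a l)\<^sup>2) \<le> 4 ^ j * (\<Sum>l\<le>j. (b l)\<^sup>2)"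
proof -
  define c :: "nat \<Rightarrow> real" where "c l = (4 ^ l - 1) / 3" for l
  define B where "B l = (\<Sum>m<l. (b m)\<^sup>2)" for l
  define S where "S l = (\<Sum>m<l. a m)" for l
  have c0: "0 \<le> c l" for l by (simp add: c_def)
  have B0: "0 \<le> B l" for l by (simp add: B_def sum_nonneg)
  \<comment> \<open>a weighted Cauchy-Schwarz inequality; used with \<open>t = 2\<close> for \<open>S\<close> and with \<open>t = 1\<close> for \<open>a\<close>\<close>
  have cross: "(x + t * y)\<^sup>2 \<le> (1 + t\<^sup>2 * g) * (x\<^sup>2 + Y)"
    if "y\<^sup>2 \<le> g * Y" "0 \<le> g" "0 \<le> Y" for x y t g Y :: real
  proof -
    have "(2 * x * (t * y))\<^sup>2 = 4 * (x\<^sup>2 * t\<^sup>2) * y\<^sup>2" by (simp add: power_mult_distrib)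
    also have "\<dots> \<le> 4 * (x\<^sup>2 * t\<^sup>2) * (g * Y)" by (rule mult_left_mono[OF that(1)]) simp
    also have "\<dots> = 4 * Y * (t\<^sup>2 * g * x\<^sup>2)" by simp
    also have "\<dots> \<le> (Y + t\<^sup>2 * g * x\<^sup>2)\<^sup>2" by (rule four_mult_le_power2_sum)
    finally have "2 * x * (t * y) \<le> Y + t\<^sup>2 * g * x\<^sup>2"
      by (rule power2_le_imp_le) (use that(2,3) in simp)
    moreover have "(t * y)\<^sup>2 \<le> t\<^sup>2 * g * Y"
      using mult_left_mono[OF that(1), of "t\<^sup>2"] by (simp add: power_mult_distrib ac_simps)
    ultimately have "x\<^sup>2 + 2 * x * (t * y) + (t * y)\<^sup>2 \<le> x\<^sup>2 + (Y + t\<^sup>2 * g * x\<^sup>2) + t\<^sup>2 * g * Y"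
      by linarith
    thus ?thesis by (simp add: power2_sum algebra_simps)
  qed
  have S: "0 \<le> S l \<and> (S l)\<^sup>2 \<le> c l * B l" if "l \<le> Suc j" for l
    using that
  proof (induction l)
    case 0
    show ?case by (simp add: S_def c_def)
  next
    case (Suc l)
    hence IH: "0 \<le> S l" "(S l)\<^sup>2 \<le> c l * B l" and l: "l \<le> j" by auto
    have "0 \<le> S (Suc l)" "S (Suc l) \<le> b l + 2 * S l"
      using IH(1) rec[OF l] a[OF l] by (auto simp: S_def)
    moreover have "(b l + 2 * S l)\<^sup>2 \<le> c (Suc l) * B (Suc l)"
      using cross[OF IH(2) c0 B0, of "b l" 2] by (simp add: c_def B_def field_simps)
    ultimately show ?case by (meson order.trans power_mono)
  qed
  have "(a l)\<^sup>2 \<le> (1 + c l) * B (Suc j)" if l: "l \<le> j" for l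
  proof -
    have "(a l)\<^sup>2 \<le> (b l + S l)\<^sup>2"
      using rec[OF l, folded S_def] by (rule power_mono) (rule a[OF l])
    also have "\<dots> \<le> (1 + c l) * ((b l)\<^sup>2 + B l)"
    proof -
      have "(S l)\<^sup>2 \<le> c l * B l" using S[of l] l by simp
      from cross[OF this c0 B0, of "b l" 1] show ?thesis by simp
    qed
    also have "(b l)\<^sup>2 + B l = B (Suc l)" by (simp add: B_def)
    also have "B (Suc l) \<le> B (Suc j)" unfolding B_def using l by (intro sum_mono2) auto
    finally show ?thesis using c0[of l] by (simp add: mult_left_mono)
  qed
  hence "(\<Sum>l\<le>j. (a l)\<^sup>2) \<le> (\<Sum>l\<le>j. (1 + c l) * B (Suc j))" by (intro sum_mono) auto
  also have "\<dots> = (\<Sum>l\<le>j. 1 + c l) * B (Suc j)" by (rule sum_distrib_right[symmetric])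
  also have "\<dots> \<le> 4 ^ j * B (Suc j)"
    unfolding c_def by (rule mult_right_mono[OF sum_one_plus_quarter_powers B0])
  finally show ?thesis unfolding B_def lessThan_Suc_atMost .
qed

text \<open>Solving \<open>L y = z\<close> for an upper triangular \<open>L\<close> proceeds from the last row upwards, and the new
entry of \<open>y\<close> is bounded by that of \<open>z\<close> plus the absolute values of the entries of \<open>y\<close> found
before. The indices are therefore reversed to match the recurrence above.\<close>

lemma sum_squares_unit_triangular:
  fixes L :: "nat \<Rightarrow> nat \<Rightarrow> real" and y :: "nat \<Rightarrow> real"
  assumes diag: "\<And>m. m \<le> j \<Longrightarrow> L m m = 1"
    and entries: "\<And>m l. m < l \<Longrightarrow> l \<le> j \<Longrightarrow> \<bar>L m l\<bar> \<le> 1"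
  shows "(\<Sum>m\<le>j. (y m)\<^sup>2) \<le> 4 ^ j * (\<Sum>m\<le>j. (\<Sum>l=m..j. L m l * y l)\<^sup>2)"
proof -
  define z where "z m = (\<Sum>l=m..j. L m l * y l)" for m
  have rev: "(\<Sum>l\<le>j. f (j - l)) = sum f {..j}" for f :: "nat \<Rightarrow> real"
    by (rule sum.nat_diff_reindex[of f "Suc j", simplified lessThan_Suc_atMost diff_Suc_Suc])
  have "(\<Sum>l\<le>j. \<bar>y (j - l)\<bar>\<^sup>2) \<le> 4 ^ j * (\<Sum>l\<le>j. \<bar>z (j - l)\<bar>\<^sup>2)"
  proof (rule sum_squares_triangular_recurrence)
    fix l assume l: "l \<le> j"
    define m where "m = j - l"
    have m: "m \<le> j" "l = j - m" using l by (auto simp: m_def)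
    have "z m = y m + (\<Sum>q\<in>{m<..j}. L m q * y q)"
      unfolding z_def using m diag[OF m(1)] by (subst sum.head) auto
    hence "\<bar>y m\<bar> \<le> \<bar>z m\<bar> + \<bar>\<Sum>q\<in>{m<..j}. L m q * y q\<bar>" by linarith
    also have "\<bar>\<Sum>q\<in>{m<..j}. L m q * y q\<bar> \<le> (\<Sum>q\<in>{m<..j}. \<bar>y q\<bar>)"
    proof (rule order.trans[OF sum_abs], rule sum_mono)
      fix q assume "q \<in> {m<..j}"
      hence "\<bar>L m q\<bar> \<le> 1" using entries by simp
      from mult_right_mono[OF this abs_ge_zero[of "y q"]]
      show "\<bar>L m q * y q\<bar> \<le> \<bar>y q\<bar>" by (simp add: abs_mult)
    qed
    also have "(\<Sum>q\<in>{m<..j}. \<bar>y q\<bar>) = (\<Sum>p<l. \<bar>y (j - p)\<bar>)"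
      by (rule sum.reindex_bij_witness[of _ "\<lambda>p. j - p" "\<lambda>q. j - q"]) (use m in auto)
    finally show "\<bar>y (j - l)\<bar> \<le> \<bar>z (j - l)\<bar> + (\<Sum>p<l. \<bar>y (j - p)\<bar>)" by (simp add: m_def)
  qed auto
  thus ?thesis using rev[of "\<lambda>m. (y m)\<^sup>2"] rev[of "\<lambda>m. (z m)\<^sup>2"] by (simp add: z_def)
qed

section \<open>Greedily pivoted Cholesky\<close>

lemma thin_svd_form:
  assumes svd: "thin_svd n k F U d V" and x: "x \<in> carrier_vec n"
  shows "(\<Sum>m<k. (col F m \<bullet> x)\<^sup>2) = (\<Sum>l<k. (d l)\<^sup>2 * (col U l \<bullet> x)\<^sup>2)"
proof -
  have U: "U \<in> carrier_mat n k" and V: "V \<in> carrier_mat k k" "transpose_mat V * V = 1\<^sub>m k"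
    and F: "F = U * mat_diag k d * transpose_mat V"
    using svd by (auto simp: thin_svd_def)
  have UD: "U * mat_diag k d \<in> carrier_mat n k" by (rule mult_carrier_mat[OF U mat_diag_dim])
  have Fc: "F \<in> carrier_mat n k" unfolding F using UD V by simp
  let ?a = "transpose_mat U *\<^sub>v x"
  have a: "?a \<in> carrier_vec k" using U x by simp
  have D: "transpose_mat (mat_diag k d) = mat_diag k d" by (rule eq_matI) (auto simp: mat_diag_def)
  have FT: "transpose_mat F = V * (mat_diag k d * transpose_mat U)"
    unfolding F using transpose_mult[OF UD, of "transpose_mat V" k] transpose_mult[OF U mat_diag_dim] V D by simp
  have DU: "mat_diag k d * transpose_mat U \<in> carrier_mat k n"
    using mult_carrier_mat[OF mat_diag_dim, of "transpose_mat U" k n] U by simp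
  have Da: "mat_diag k d *\<^sub>v ?a \<in> carrier_vec k" using a by (rule mult_mat_vec_carrier[OF mat_diag_dim])
  have "transpose_mat F *\<^sub>v x = V *\<^sub>v (mat_diag k d *\<^sub>v ?a)"
    unfolding FT using assoc_mult_mat_vec[OF V(1) DU x]
      assoc_mult_mat_vec[OF mat_diag_dim, of "transpose_mat U" k n x] U x by simp
  hence "(\<Sum>m<k. (col F m \<bullet> x)\<^sup>2) = (mat_diag k d *\<^sub>v ?a) \<bullet> (mat_diag k d *\<^sub>v ?a)"
    using gram_form[OF Fc x] isometry_scalar_prod[OF V Da] by simp
  also have "\<dots> = (\<Sum>l<k. (d l)\<^sup>2 * (col U l \<bullet> x)\<^sup>2)"
    using U x unfolding mat_diag_mult_vec[OF a]
    by (subst scalar_prod_eq_sum[of _ k]) (auto simp: power2_eq_square ac_simps)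
  finally show ?thesis .
qed

locale greedy_cholesky =
  fixes n k :: nat and K :: "real mat" and s :: "nat \<Rightarrow> nat"
  assumes psd: "psd_mat n K" and greedy: "greedy_pivots n k K s"
begin

abbreviation residual :: "nat \<Rightarrow> real mat" where
  "residual j \<equiv> chol_residual K s j"

definition pivot_col :: "nat \<Rightarrow> real vec" where
  "pivot_col j = col (residual j) (s j)"

definition pivot :: "nat \<Rightarrow> real" where
  "pivot j = residual j $$ (s j, s j)"

lemma pivot_index: "j < k \<Longrightarrow> s j < n"
  and diag_le_pivot: "j < k \<Longrightarrow> i < n \<Longrightarrow> residual j $$ (i, i) \<le> pivot j"
  using greedy by (auto simp: greedy_pivots_def pivot_def)

lemma residual_Suc':
  assumes "residual j \<in> carrier_mat n n" "j < k"
  shows "residual (Suc j) = residual j - (1 / pivot j) \<cdot>\<^sub>m outer_prod (pivot_col j)"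
  using assms pivot_index[OF assms(2)] by (simp add: Let_def pivot_def pivot_col_def)

lemma residual_psd:
  assumes "j \<le> k"
  shows "psd_mat n (residual j)"
  using assms
proof (induction j)
  case (Suc j)
  hence IH: "psd_mat n (residual j)" and j: "j < k" by auto
  show ?case
    using psd_cholesky_step[OF IH pivot_index[OF j]] residual_Suc'[OF psd_matD(1)[OF IH] j]
    by (simp only: pivot_def pivot_col_def)
qed (use psd in simp)

lemmas residual_carrier = psd_matD(1)[OF residual_psd]

lemma residual_Suc:
  assumes "j < k"
  shows "residual (Suc j) = residual j - (1 / pivot j) \<cdot>\<^sub>m outer_prod (pivot_col j)"
  using residual_Suc'[OF residual_carrier assms] assms by simp

lemma pivot_col_carrier: "j < k \<Longrightarrow> pivot_col j \<in> carrier_vec n"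
  using residual_carrier[of j] pivot_index[of j] by (simp add: pivot_col_def col_dim carrier_vecI)

lemma pivot_col_index: "j < k \<Longrightarrow> i < n \<Longrightarrow> pivot_col j $ i = residual j $$ (i, s j)"
  using residual_carrier[of j] pivot_index[of j] by (simp add: pivot_col_def)

lemma pivot_nonneg: "j < k \<Longrightarrow> 0 \<le> pivot j"
  using psd_diag_nonneg[OF residual_psd[of j] pivot_index[of j]] by (simp add: pivot_def)

lemma residual_Suc_index:
  assumes "j < k" "i < n" "t < n"
  shows "residual (Suc j) $$ (i, t) = residual j $$ (i, t) - pivot_col j $ i * pivot_col j $ t / pivot j"
  using assms residual_carrier[of j] pivot_col_carrier[of j]
  by (simp add: residual_Suc outer_prod_def del: chol_residual.simps)

text \<open>This is where greedy pivoting enters: an off-diagonal entry is bounded by the geometric mean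
of two diagonal entries, and both are at most the pivot.\<close>

lemma pivot_col_bound:
  assumes j: "j < k" and i: "i < n"
  shows "\<bar>pivot_col j $ i\<bar> \<le> pivot j"
proof -
  have "(pivot_col j $ i)\<^sup>2 \<le> residual j $$ (i, i) * pivot j"
    using psd_entry_square_le[OF residual_psd i pivot_index[OF j]] j i
    by (simp add: pivot_col_index pivot_def)
  also have "\<dots> \<le> pivot j * pivot j"
    using diag_le_pivot[OF j i] pivot_nonneg[OF j] by (rule mult_right_mono)
  finally have "\<bar>pivot_col j $ i\<bar>\<^sup>2 \<le> (pivot j)\<^sup>2" by (simp add: power2_eq_square)
  thus ?thesis by (rule power2_le_imp_le) (rule pivot_nonneg[OF j])
qed

text \<open>The step with pivot \<open>s m\<close> clears that row and column, and later steps subtract multiples of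
columns that vanish there already. If the pivot is zero, its column is zero by
\<open>pivot_col_bound\<close>.\<close>

lemma residual_pivot_column_zero:
  assumes "m < j" "j \<le> k" "i < n"
  shows "residual j $$ (i, s m) = 0"
  using assms
proof (induction j arbitrary: i)
  case (Suc j)
  hence j: "j < k" by simp
  have sm: "s m < n" using pivot_index Suc.prems by simp
  note E = residual_Suc_index[OF j \<open>i < n\<close> sm]
  show ?case
  proof (cases "m = j")
    case True
    have "pivot_col j $ s j = pivot j" using pivot_col_index[OF j pivot_index[OF j]] by (simp add: pivot_def)
    moreover have "pivot_col j $ i = 0" if "pivot j = 0" using pivot_col_bound[OF j \<open>i < n\<close>] that by simp
    ultimately show ?thesis
      using E True pivot_col_index[OF j \<open>i < n\<close>] by (cases "pivot j = 0") auto
  next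
    case False
    hence mj: "m < j" using Suc.prems by simp
    have "pivot_col j $ s m = residual j $$ (s j, s m)"
      using pivot_col_index[OF j sm] symmetric_entry[OF psd_matD(1,2)[OF residual_psd]] j sm pivot_index[OF j]
      by simp
    also have "\<dots> = 0" using Suc.IH[OF mj _ pivot_index[OF j]] j by simp
    finally show ?thesis using E Suc.IH[OF mj _ \<open>i < n\<close>] j by simp
  qed
qed simp

lemma pivot_col_earlier_pivot:
  assumes "m < j" "j < k"
  shows "pivot_col j $ s m = 0"
proof -
  have i: "s m < n" "s j < n" using assms pivot_index by auto
  have "pivot_col j $ s m = residual j $$ (s j, s m)"
    using pivot_col_index[OF assms(2) i(1)] symmetric_entry[OF psd_matD(1,2)[OF residual_psd]] assms i by simp
  thus ?thesis using residual_pivot_column_zero assms i by simp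
qed

lemma residual_diag_antimono:
  assumes "m \<le> j" "j \<le> k" "i < n"
  shows "residual j $$ (i, i) \<le> residual m $$ (i, i)"
  using assms
proof (induction j rule: dec_induct)
  case (step j)
  hence j: "j < k" by simp
  have "residual (Suc j) $$ (i, i) \<le> residual j $$ (i, i)"
    using residual_Suc_index[OF j \<open>i < n\<close> \<open>i < n\<close>] pivot_nonneg[OF j] by simp
  thus ?case using step by simp
qed simp

lemma pivot_antimono:
  assumes "m \<le> j" "j < k"
  shows "pivot j \<le> pivot m"
  using residual_diag_antimono[OF assms(1), of "s j"] diag_le_pivot[of m "s j"] pivot_index assms
  by (force simp: pivot_def)

text \<open>A repeated pivot index would pick a diagonal entry that was cleared before, hence a zero
pivot.\<close>

lemma pivots_distinct:
  assumes "j < k" "0 < pivot j"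
  shows "inj_on s {..j}"
proof (rule linorder_inj_onI)
  fix a b assume ab: "a < b" "a \<in> {..j}" "b \<in> {..j}"
  hence b: "b < k" "0 < pivot b" using pivot_antimono[of b j] assms by auto
  have "pivot_col b $ s b = pivot b" using pivot_col_index[OF b(1) pivot_index[OF b(1)]] by (simp add: pivot_def)
  thus "s a \<noteq> s b" using pivot_col_earlier_pivot[OF ab(1) b(1)] b(2) by auto
qed auto

lemma residual_form:
  assumes "j \<le> k" and x: "x \<in> carrier_vec n"
  shows "x \<bullet> (residual j *\<^sub>v x) = x \<bullet> (K *\<^sub>v x) - (\<Sum>m<j. (pivot_col m \<bullet> x)\<^sup>2 / pivot m)"
  using assms(1)
proof (induction j)
  case (Suc j)
  hence j: "j < k" by simp
  show ?case
    using Suc.IH j residual_Suc[OF j] rank_one_downdate_form[OF residual_carrier pivot_col_carrier x, of j j]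
    by (simp del: chol_residual.simps)
qed simp

text \<open>The \<open>j\<close> earlier pivot positions contribute 0 to the trace and each other position at most the
current pivot. If that pivot is 0, the earlier indices may repeat, but the whole diagonal
vanishes.\<close>

lemma residual_trace_le:
  assumes j: "j < k"
  shows "(\<Sum>i<n. residual j $$ (i, i)) \<le> (real n - real j) * pivot j"
proof (cases "pivot j = 0")
  case True
  hence "residual j $$ (i, i) \<le> 0" if "i < n" for i using diag_le_pivot[OF j that] by simp
  thus ?thesis using True by (auto intro: sum_nonpos)
next
  case False
  hence pos: "0 < pivot j" using pivot_nonneg[OF j] by simp
  have sub: "s ` {..<j} \<subseteq> {..<n}" using pivot_index j by auto
  have card: "card (s ` {..<j}) = j"
    using card_image[OF inj_on_subset[OF pivots_distinct[OF j pos]], of "{..<j}"]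
    by (simp add: lessThan_subset_iff subset_iff)
  hence jn: "j \<le> n" using card_mono[OF _ sub] by simp
  have "(\<Sum>i<n. residual j $$ (i, i)) = (\<Sum>i\<in>{..<n} - s ` {..<j}. residual j $$ (i, i))"
    using residual_pivot_column_zero[of _ j] j pivot_index by (intro sum.mono_neutral_right) auto
  also have "\<dots> \<le> (\<Sum>i\<in>{..<n} - s ` {..<j}. pivot j)"
    using diag_le_pivot[OF j] by (intro sum_mono) auto
  also have "\<dots> = (real n - real j) * pivot j"
    using card_Diff_subset[OF _ sub] card jn by (simp add: of_nat_diff)
  finally show ?thesis .
qed

text \<open>On vectors orthogonal to the first \<open>j\<close> pivot columns, \<open>K\<close> has the same quadratic form as the
residual.\<close>

lemma eigenvalue_le_pivot:
  assumes j: "j < k" "k \<le> n"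
  shows "nth_eigenvalue K (Suc j) \<le> (real n - real j) * pivot j"
proof (rule eigenvalue_upper_bound[OF psd_matD(1,2)[OF psd], where C = "pivot_col ` {..<j}"])
  show "j < n" using j by simp
  show "pivot_col ` {..<j} \<subseteq> carrier_vec n" using pivot_col_carrier j by auto
  show "card (pivot_col ` {..<j}) \<le> j" using card_image_le[of "{..<j}" pivot_col] by simp
  fix x assume x: "x \<in> carrier_vec n" and orth: "\<And>c. c \<in> pivot_col ` {..<j} \<Longrightarrow> c \<bullet> x = 0"
  have "x \<bullet> (K *\<^sub>v x) = x \<bullet> (residual j *\<^sub>v x)" using residual_form[of j x] j x orth by simp
  also have "\<dots> \<le> (\<Sum>i<n. residual j $$ (i, i)) * (x \<bullet> x)"
    using j by (intro psd_form_le_trace[OF residual_psd x]) simp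
  also have "\<dots> \<le> (real n - real j) * pivot j * (x \<bullet> x)"
    by (rule mult_right_mono[OF residual_trace_le[OF j(1)] real_scalar_prod_self(1)[OF x]])
  finally show "x \<bullet> (K *\<^sub>v x) \<le> (real n - real j) * pivot j * (x \<bullet> x)" .
qed simp

text \<open>Only the pivot coordinates \<open>y l = x $ s l\<close> contribute, and a pivot column vanishes at earlier
pivots, so the products \<open>pivot_col m \<bullet> x\<close> are a unit triangular system in \<open>y\<close>, scaled by
pivots that are all at least \<open>pivot j\<close>.\<close>

lemma factor_form_lower:
  assumes j: "j < k" and pos: "0 < pivot j" and x: "x \<in> carrier_vec n"
    and supp: "\<And>i. i < n \<Longrightarrow> i \<notin> s ` {..j} \<Longrightarrow> x $ i = 0"
  shows "pivot j / 4 ^ j * (x \<bullet> x) \<le> (\<Sum>m\<le>j. (pivot_col m \<bullet> x)\<^sup>2 / pivot m)"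
proof -
  note inj = pivots_distinct[OF j pos]
  have sub: "s ` {..j} \<subseteq> {..<n}" using pivot_index j by auto
  have pm: "pivot j \<le> pivot m" "0 < pivot m" if "m \<le> j" for m
    using pivot_antimono[OF that j] pos by auto
  have on_pivots: "(\<Sum>i<n. f i * x $ i) = (\<Sum>l\<le>j. f (s l) * x $ s l)" for f :: "nat \<Rightarrow> real"
  proof -
    have "(\<Sum>i<n. f i * x $ i) = (\<Sum>i\<in>s ` {..j}. f i * x $ i)"
      using sub supp by (intro sum.mono_neutral_right) auto
    thus ?thesis by (simp add: sum.reindex[OF inj])
  qed
  define L where "L m l = pivot_col m $ s l / pivot m" for m l
  define y where "y l = x $ s l" for l
  have xx: "x \<bullet> x = (\<Sum>l\<le>j. (y l)\<^sup>2)"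
    using on_pivots[of "\<lambda>i. x $ i"] x by (simp add: scalar_prod_eq_sum[of _ n] y_def power2_eq_square)
  have w: "pivot_col m \<bullet> x = pivot m * (\<Sum>l=m..j. L m l * y l)" if m: "m \<le> j" for m
  proof -
    have "pivot_col m \<bullet> x = (\<Sum>l\<le>j. pivot_col m $ s l * y l)"
      using on_pivots[of "\<lambda>i. pivot_col m $ i"] x by (simp add: scalar_prod_eq_sum[of _ n] y_def)
    also have "\<dots> = (\<Sum>l=m..j. pivot_col m $ s l * y l)"
      using pivot_col_earlier_pivot[of _ m] m j by (intro sum.mono_neutral_right) auto
    also have "\<dots> = pivot m * (\<Sum>l=m..j. L m l * y l)"
      using pm(2)[OF m] by (simp add: sum_distrib_left L_def)
    finally show ?thesis .
  qed
  have tri: "(\<Sum>m\<le>j. (y m)\<^sup>2) \<le> 4 ^ j * (\<Sum>m\<le>j. (\<Sum>l=m..j. L m l * y l)\<^sup>2)"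
  proof (rule sum_squares_unit_triangular)
    fix m assume m: "m \<le> j"
    show "L m m = 1"
      using pm(2)[OF m] pivot_col_index[of m "s m"] pivot_index[of m] m j by (simp add: L_def pivot_def)
  next
    fix m l assume "m < l" "l \<le> j"
    thus "\<bar>L m l\<bar> \<le> 1"
      using pm(2)[of m] pivot_col_bound[of m "s l"] pivot_index[of l] j by (simp add: L_def)
  qed
  have "pivot j / 4 ^ j * (x \<bullet> x) \<le> pivot j * (\<Sum>m\<le>j. (\<Sum>l=m..j. L m l * y l)\<^sup>2)"
    using mult_left_mono[OF tri, of "pivot j / 4 ^ j"] pos by (simp add: xx)
  also have "\<dots> = (\<Sum>m\<le>j. pivot j * (\<Sum>l=m..j. L m l * y l)\<^sup>2)" by (rule sum_distrib_left)
  also have "\<dots> \<le> (\<Sum>m\<le>j. (pivot_col m \<bullet> x)\<^sup>2 / pivot m)"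
  proof (rule sum_mono)
    fix m assume "m \<in> {..j}"
    hence m: "m \<le> j" by simp
    have "(pivot_col m \<bullet> x)\<^sup>2 / pivot m = pivot m * (\<Sum>l=m..j. L m l * y l)\<^sup>2"
      using pm(2)[OF m] unfolding w[OF m] power_mult_distrib by (simp add: power2_eq_square)
    thus "pivot j * (\<Sum>l=m..j. L m l * y l)\<^sup>2 \<le> (pivot_col m \<bullet> x)\<^sup>2 / pivot m"
      using mult_right_mono[OF pm(1)[OF m]] by simp
  qed
  finally show ?thesis .
qed

lemma chol_factor_form:
  assumes x: "x \<in> carrier_vec n"
  shows "(\<Sum>m<k. (col (chol_factor n k K s) m \<bullet> x)\<^sup>2) = (\<Sum>m<k. (pivot_col m \<bullet> x)\<^sup>2 / pivot m)"
proof (rule sum.cong)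
  fix m assume "m \<in> {..<k}"
  hence m: "m < k" by simp
  have "col (chol_factor n k K s) m = (1 / sqrt (pivot m)) \<cdot>\<^sub>v pivot_col m"
    using m residual_carrier[of m] pivot_index[OF m]
    by (intro eq_vecI) (auto simp: chol_factor_def Let_def pivot_col_def pivot_def)
  hence "col (chol_factor n k K s) m \<bullet> x = (pivot_col m \<bullet> x) / sqrt (pivot m)"
    using pivot_col_carrier[OF m] x by simp
  thus "(col (chol_factor n k K s) m \<bullet> x)\<^sup>2 = (pivot_col m \<bullet> x)\<^sup>2 / pivot m"
    using pivot_nonneg[OF m] by (simp add: power_divide)
qed simp

lemma chol_factor_form_le:
  assumes x: "x \<in> carrier_vec n"
  shows "(\<Sum>m<k. (col (chol_factor n k K s) m \<bullet> x)\<^sup>2) \<le> x \<bullet> (K *\<^sub>v x)"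
  using residual_form[OF order.refl x] psd_matD(3)[OF residual_psd[OF order.refl] x] chol_factor_form[OF x]
  by simp

text \<open>The test subspace consists of the vectors supported on the first \<open>j + 1\<close> pivot coordinates,
cut out by \<open>n - j - 1\<close> equations. These coordinates are known to be distinct for a positive pivot; for
a zero pivot \<open>eigenvalue_le_pivot\<close> already makes the left-hand side nonpositive.\<close>

lemma singular_value_lower_bound:
  assumes svd: "thin_svd n k (chol_factor n k K s) U d V" and j: "j < k" and kn: "k \<le> n"
  shows "nth_eigenvalue K (Suc j) * c_coeff n (Suc j) \<le> (d j)\<^sup>2"
proof -
  let ?F = "chol_factor n k K s"
  have U: "U \<in> carrier_mat n k" "transpose_mat U * U = 1\<^sub>m k"
    and d: "\<And>i. i < k \<Longrightarrow> 0 \<le> d i" "\<And>i j. i \<le> j \<Longrightarrow> j < k \<Longrightarrow> d j \<le> d i"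
    using svd by (auto simp: thin_svd_def)
  have nj: "0 < real n - real j" using j kn by simp
  have "nth_eigenvalue K (Suc j) * c_coeff n (Suc j) = nth_eigenvalue K (Suc j) / (real n - real j) / 4 ^ j"
    by (simp add: c_coeff_def)
  also have "\<dots> \<le> pivot j / 4 ^ j"
    using eigenvalue_le_pivot[OF j kn] nj by (intro divide_right_mono) (simp_all add: field_simps)
  also have "\<dots> \<le> (d j)\<^sup>2"
  proof (cases "pivot j = 0")
    case False
    hence pos: "0 < pivot j" using pivot_nonneg[OF j] by simp
    let ?C = "unit_vec n ` ({..<n} - s ` {..j}) :: real vec set"
    have sub: "s ` {..j} \<subseteq> {..<n}" using pivot_index j by auto
    have "card (s ` {..j}) = Suc j" using card_image[OF pivots_distinct[OF j pos]] by simp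
    hence "card ({..<n} - s ` {..j}) = n - Suc j" using card_Diff_subset[OF _ sub] by simp
    hence card: "card ?C + j < n" using card_image_le[of "{..<n} - s ` {..j}" "unit_vec n :: nat \<Rightarrow> real vec"] j kn by simp
    show ?thesis
    proof (rule courant_fischer_lower[OF U, where d = "\<lambda>l. (d l)\<^sup>2" and C = ?C])
      show "(d b)\<^sup>2 \<le> (d a)\<^sup>2" if "a \<le> b" "b < k" for a b
        using d that by (intro power_mono) auto
      fix x :: "real vec" assume x: "x \<in> carrier_vec n" and orth: "\<And>c. c \<in> ?C \<Longrightarrow> c \<bullet> x = 0"
      have "x $ i = 0" if "i < n" "i \<notin> s ` {..j}" for i
        using orth[of "unit_vec n i"] that x by simp
      hence "pivot j / 4 ^ j * (x \<bullet> x) \<le> (\<Sum>m\<le>j. (pivot_col m \<bullet> x)\<^sup>2 / pivot m)"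
        by (intro factor_form_lower[OF j pos x]) auto
      also have "\<dots> \<le> (\<Sum>m<k. (pivot_col m \<bullet> x)\<^sup>2 / pivot m)"
        using j pivot_nonneg by (intro sum_mono2) auto
      finally show "pivot j / 4 ^ j * (x \<bullet> x) \<le> (\<Sum>l<k. (d l)\<^sup>2 * (col U l \<bullet> x)\<^sup>2)"
        by (simp add: chol_factor_form[OF x, symmetric] thin_svd_form[OF svd x])
    qed (use j card in auto)
  qed simp
  finally show ?thesis .
qed

end

section \<open>The block selected by rank-revealing QR\<close>

text \<open>The projection \<open>U U\<^sup>T\<close> fixes the range of \<open>U\<close>, which has dimension \<open>k\<close> and therefore contains a
nonzero vector orthogonal to the first \<open>j\<close> eigenvectors. The range is parametrized by \<open>y\<close>, so
the equations are pulled back along \<open>U\<close>.\<close>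

lemma isometry_range_eigenvalue:
  fixes U :: "real mat"
  assumes U: "U \<in> carrier_mat n k" and UU: "transpose_mat U * U = 1\<^sub>m k" and j: "j < k" "k \<le> n"
  shows "1 \<le> nth_eigenvalue (U * transpose_mat U) (Suc j)"
proof -
  let ?A = "U * transpose_mat U"
  have A: "?A \<in> carrier_mat n n" "transpose_mat ?A = ?A"
    using U transpose_mult[OF U, of "transpose_mat U" n] by auto
  obtain W where W: "W \<in> carrier_mat n n" "transpose_mat W * W = 1\<^sub>m n" "W * transpose_mat W = 1\<^sub>m n"
    and dec: "?A = W * mat_diag n (\<lambda>i. nth_eigenvalue ?A (Suc i)) * transpose_mat W"
    and anti: "\<And>i j. i \<le> j \<Longrightarrow> j < n \<Longrightarrow> nth_eigenvalue ?A (Suc j) \<le> nth_eigenvalue ?A (Suc i)"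
    using symmetric_spectral_decomposition[OF A] by metis
  let ?C = "(\<lambda>i. transpose_mat U *\<^sub>v col W i) ` {..<j}"
  have "card ?C < k" using card_image_le[of "{..<j}" "\<lambda>i. transpose_mat U *\<^sub>v col W i"] j by simp
  moreover have "?C \<subseteq> carrier_vec k" using U by (auto intro!: carrier_vecI)
  ultimately obtain y where y: "y \<in> carrier_vec k" "y \<noteq> 0\<^sub>v k"
    and orth: "\<And>c. c \<in> ?C \<Longrightarrow> c \<bullet> y = 0"
    using nonzero_common_zero[of ?C k] by auto
  define x where "x = U *\<^sub>v y"
  have x: "x \<in> carrier_vec n" using U y by (simp add: x_def)
  have xx: "x \<bullet> x = y \<bullet> y" unfolding x_def by (rule isometry_scalar_prod[OF U UU y(1)])
  have UTx: "transpose_mat U *\<^sub>v x = y"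
    using assoc_mult_mat_vec[of "transpose_mat U" k n U k y] U UU y by (simp add: x_def)
  have "?A *\<^sub>v x = x" using assoc_mult_mat_vec[OF U, of "transpose_mat U" n x] U x UTx by (simp add: x_def)
  hence "x \<bullet> x = x \<bullet> (?A *\<^sub>v x)" by simp
  also have "\<dots> = (\<Sum>l<n. nth_eigenvalue ?A (Suc l) * (col W l \<bullet> x)\<^sup>2)"
    using diagonalized_form[OF W(1) x, of "\<lambda>i. nth_eigenvalue ?A (Suc i)", folded dec] .
  also have "\<dots> \<le> (\<Sum>l<n. nth_eigenvalue ?A (Suc j) * (col W l \<bullet> x)\<^sup>2)"
  proof (rule sum_mono)
    fix l assume l: "l \<in> {..<n}"
    have "col W l \<bullet> x = 0" if "l < j"
      using orth[of "transpose_mat U *\<^sub>v col W l"] that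
        transpose_vec_mult_scalar[OF U y(1), of "col W l"] W l by (simp add: x_def)
    thus "nth_eigenvalue ?A (Suc l) * (col W l \<bullet> x)\<^sup>2 \<le> nth_eigenvalue ?A (Suc j) * (col W l \<bullet> x)\<^sup>2"
      using anti[of j l] l by (cases "l < j") (auto intro!: mult_right_mono)
  qed
  also have "\<dots> = nth_eigenvalue ?A (Suc j) * (x \<bullet> x)"
    by (simp add: sum_distrib_left[symmetric] parseval_identity[OF W(1,3) x])
  finally show ?thesis using real_scalar_prod_self(3)[OF y] xx by simp
qed

lemma first_cols_carrier: "M \<in> carrier_mat a b \<Longrightarrow> first_cols k M \<in> carrier_mat a k"
  by (simp add: first_cols_def)

lemma first_cols_mult:
  assumes "A \<in> carrier_mat a b" "B \<in> carrier_mat b c" "k \<le> c"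
  shows "first_cols k (A * B) = A * first_cols k B"
proof (rule eq_matI)
  fix i j assume ij: "i < dim_row (A * first_cols k B)" "j < dim_col (A * first_cols k B)"
  have "col (first_cols k B) j = col B j"
    using assms ij by (intro eq_vecI) (auto simp: first_cols_def)
  thus "first_cols k (A * B) $$ (i, j) = (A * first_cols k B) $$ (i, j)"
    using assms ij by (simp add: first_cols_def)
qed (use assms in \<open>auto simp: first_cols_def\<close>)

lemma first_cols_permutation_selection:
  assumes M: "permutation_matrix n M" and k: "k \<le> n"
  shows "selection_operator n k (first_cols k M)"
proof -
  obtain p where p: "p permutes {..<n}" and Mp: "M = mat n n (\<lambda>(i, j). if i = p j then 1 else 0)"
    using M by (auto simp: permutation_matrix_def)
  have pn: "p j < n" if "j < k" for j using permutes_in_image[OF p, of j] that k by simp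
  have col: "col (first_cols k M) j = unit_vec n (p j)" if "j < k" for j
    using that k pn by (intro eq_vecI) (auto simp: first_cols_def Mp)
  have cols: "cols (first_cols k M) = map (\<lambda>j. unit_vec n (p j)) [0..<k]"
    using col by (auto simp: cols_def first_cols_def intro!: nth_equalityI)
  have "inj_on (\<lambda>j. unit_vec n (p j) :: real vec) {0..<k}"
  proof (rule inj_onI)
    fix a b assume ab: "a \<in> {0..<k}" "b \<in> {0..<k}" "unit_vec n (p a) = (unit_vec n (p b) :: real vec)"
    hence "(unit_vec n (p a) :: real vec) $ p a = unit_vec n (p b) $ p a" by simp
    hence "p a = p b" using pn ab by (auto split: if_splits)
    thus "a = b" using permutes_inj[OF p] by (simp add: inj_eq)
  qed
  hence "distinct (cols (first_cols k M))" by (simp add: cols distinct_map)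
  moreover have "set (cols (first_cols k M)) \<subseteq> set (cols (1\<^sub>m n))"
    unfolding cols using pn by (auto simp: cols_def image_iff)
  moreover have "first_cols k M \<in> carrier_mat n k" by (simp add: first_cols_def Mp)
  ultimately show ?thesis by (simp add: selection_operator_def)
qed

lemma gram_matrix_form:
  fixes R :: "real mat"
  assumes R: "R \<in> carrier_mat m k" and y: "y \<in> carrier_vec k"
  shows "y \<bullet> ((transpose_mat R * R) *\<^sub>v y) = (R *\<^sub>v y) \<bullet> (R *\<^sub>v y)"
proof -
  have "(transpose_mat R * R) *\<^sub>v y = transpose_mat R *\<^sub>v (R *\<^sub>v y)" using R y by simp
  hence "y \<bullet> ((transpose_mat R * R) *\<^sub>v y) = (transpose_mat R *\<^sub>v (R *\<^sub>v y)) \<bullet> y"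
    using R y comm_scalar_prod[of y k "transpose_mat R *\<^sub>v (R *\<^sub>v y)"] by simp
  thus ?thesis using transpose_vec_mult_scalar[OF R y, of "R *\<^sub>v y"] R y by simp
qed

lemma compression_form:
  fixes S :: "real mat"
  assumes K: "K \<in> carrier_mat n n" and S: "S \<in> carrier_mat n k" and y: "y \<in> carrier_vec k"
  shows "y \<bullet> ((transpose_mat S * K * S) *\<^sub>v y) = (S *\<^sub>v y) \<bullet> (K *\<^sub>v (S *\<^sub>v y))"
proof -
  have z: "K *\<^sub>v (S *\<^sub>v y) \<in> carrier_vec n" using K S y by simp
  have "(transpose_mat S * K * S) *\<^sub>v y = transpose_mat S *\<^sub>v (K *\<^sub>v (S *\<^sub>v y))"
    using K S y assoc_mult_mat_vec[of "transpose_mat S * K" k n S k y]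
      assoc_mult_mat_vec[of "transpose_mat S" k n K n "S *\<^sub>v y"] by simp
  moreover have "transpose_mat S *\<^sub>v (K *\<^sub>v (S *\<^sub>v y)) \<in> carrier_vec k" using S z by simp
  ultimately have "y \<bullet> ((transpose_mat S * K * S) *\<^sub>v y) = (K *\<^sub>v (S *\<^sub>v y)) \<bullet> (S *\<^sub>v y)"
    using transpose_vec_mult_scalar[OF S y z] comm_scalar_prod[OF y] by simp
  thus ?thesis using comm_scalar_prod[OF z, of "S *\<^sub>v y"] S y by simp
qed

lemma compression_psd:
  assumes K: "psd_mat n K" and S: "S \<in> carrier_mat n k"
  shows "psd_mat k (transpose_mat S * K * S)"
  unfolding psd_mat_def
proof (intro conjI ballI)
  note Kc = psd_matD(1,2)[OF K]
  show "transpose_mat S * K * S \<in> carrier_mat k k" using Kc S by simp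
  show "transpose_mat (transpose_mat S * K * S) = transpose_mat S * K * S"
    using transpose_mult[of "transpose_mat S * K" k n S k] transpose_mult[of "transpose_mat S" k n K n] Kc S
    by simp
  show "0 \<le> y \<bullet> ((transpose_mat S * K * S) *\<^sub>v y)" if "y \<in> carrier_vec k" for y
    using compression_form[OF Kc(1) S that] psd_matD(3)[OF K, of "S *\<^sub>v y"] S that by simp
qed

text \<open>The test subspace consists of the \<open>y\<close> for which \<open>G y\<close> vanishes after coordinate \<open>j\<close>; on it the
form \<open>\<Sum>l<k. d l * (row G l \<bullet> y)\<^sup>2\<close> is at least \<open>d j |G y|\<^sup>2\<close>.\<close>

lemma compression_eigenvalue_lower_bound:
  assumes N: "psd_mat k N" and G: "G \<in> carrier_mat k k" and g: "0 \<le> g"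
    and d: "\<And>i j. i \<le> j \<Longrightarrow> j < k \<Longrightarrow> d j \<le> d i" "\<And>i. i < k \<Longrightarrow> 0 \<le> d i"
    and form: "\<And>y. y \<in> carrier_vec k \<Longrightarrow> (\<Sum>l<k. d l * (row G l \<bullet> y)\<^sup>2) \<le> y \<bullet> (N *\<^sub>v y)"
    and G_lower: "\<And>y. y \<in> carrier_vec k \<Longrightarrow> g * (y \<bullet> y) \<le> (G *\<^sub>v y) \<bullet> (G *\<^sub>v y)"
    and j: "j < k"
  shows "d j * g \<le> nth_eigenvalue N (Suc j)"
proof (rule eigenvalue_lower_bound[OF N j, where C = "row G ` {j<..<k}"])
  show "row G ` {j<..<k} \<subseteq> carrier_vec k" using G by auto
  show "card (row G ` {j<..<k}) + j < k" using card_image_le[of "{j<..<k}" "row G"] j by simp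
  fix y assume y: "y \<in> carrier_vec k" and orth: "\<And>c. c \<in> row G ` {j<..<k} \<Longrightarrow> c \<bullet> y = 0"
  have "d j * g * (y \<bullet> y) \<le> d j * ((G *\<^sub>v y) \<bullet> (G *\<^sub>v y))"
    using mult_left_mono[OF G_lower[OF y] d(2)[OF j]] by (simp add: mult.assoc)
  also have "(G *\<^sub>v y) \<bullet> (G *\<^sub>v y) = (\<Sum>l<k. (row G l \<bullet> y)\<^sup>2)"
    using G y by (subst scalar_prod_eq_sum[of _ k]) (auto simp: power2_eq_square)
  also have "d j * \<dots> = (\<Sum>l<k. d j * (row G l \<bullet> y)\<^sup>2)" by (rule sum_distrib_left)
  also have "\<dots> \<le> (\<Sum>l<k. d l * (row G l \<bullet> y)\<^sup>2)"
  proof (rule sum_mono)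
    fix l assume "l \<in> {..<k}"
    thus "d j * (row G l \<bullet> y)\<^sup>2 \<le> d l * (row G l \<bullet> y)\<^sup>2"
      using orth[of "row G l"] d(1)[of l j] j by (cases "l \<le> j") (auto intro!: mult_right_mono)
  qed
  also have "\<dots> \<le> y \<bullet> (N *\<^sub>v y)" by (rule form[OF y])
  finally show "d j * g * (y \<bullet> y) \<le> y \<bullet> (N *\<^sub>v y)" .
qed simp

text \<open>All nonzero singular values of \<open>U\<^sup>T\<close> are 1, so the guarantee for the least singular value of
\<open>R11\<close> bounds \<open>|R11 y|\<close> from below, and the orthogonal factor \<open>Q\<close> preserves lengths.\<close>

lemma sRRQR_selected_block_lower:
  assumes qr: "sRRQR k n f (transpose_mat U) M" and U: "U \<in> carrier_mat n k" "transpose_mat U * U = 1\<^sub>m k"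
    and k: "1 \<le> k" "k < n" and y: "y \<in> carrier_vec k"
  defines "G \<equiv> transpose_mat U * first_cols k M"
  shows "1 / (1 + f\<^sup>2 * real k * (real n - real k)) * (y \<bullet> y) \<le> (G *\<^sub>v y) \<bullet> (G *\<^sub>v y)"
proof -
  let ?q = "1 + f\<^sup>2 * real k * (real n - real k)"
  have q: "0 < ?q" using k by (intro add_pos_nonneg) auto
  obtain Q R where Q: "Q \<in> carrier_mat k k" "transpose_mat Q * Q = 1\<^sub>m k" and R: "R \<in> carrier_mat k n"
    and QR: "transpose_mat U * M = Q * R"
    and sv: "singular_value (transpose_mat U) k / sqrt ?q \<le> singular_value (first_cols k R) k"
    using qr k unfolding sRRQR_def by (metis atLeastAtMost_iff order.refl)
  have M: "M \<in> carrier_mat n n" using qr by (auto simp: sRRQR_def permutation_matrix_def)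
  let ?R = "first_cols k R"
  have Rc: "?R \<in> carrier_mat k k" by (rule first_cols_carrier[OF R])
  have G: "G = Q * ?R"
    using first_cols_mult[OF _ M, of "transpose_mat U" k k] first_cols_mult[OF Q(1) R, of k] QR U k
    by (simp add: G_def)
  have "1 \<le> singular_value (transpose_mat U) k"
    using isometry_range_eigenvalue[OF U, of "k - 1"] k by (simp add: singular_value_def)
  hence "1 / sqrt ?q \<le> singular_value (transpose_mat U) k / sqrt ?q"
    using q by (intro divide_right_mono) auto
  also note sv
  finally have "sqrt (1 / ?q) \<le> sqrt (nth_eigenvalue (transpose_mat ?R * ?R) k)"
    by (simp add: singular_value_def real_sqrt_divide)
  hence ev: "1 / ?q \<le> nth_eigenvalue (transpose_mat ?R * ?R) k" by simp
  have RR: "transpose_mat ?R * ?R \<in> carrier_mat k k"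
    "transpose_mat (transpose_mat ?R * ?R) = transpose_mat ?R * ?R"
    using Rc transpose_mult[of "transpose_mat ?R" k k ?R k] by auto
  have "1 / ?q * (y \<bullet> y) \<le> nth_eigenvalue (transpose_mat ?R * ?R) k * (y \<bullet> y)"
    by (rule mult_right_mono[OF ev real_scalar_prod_self(1)[OF y]])
  also have "\<dots> \<le> y \<bullet> ((transpose_mat ?R * ?R) *\<^sub>v y)"
    using least_eigenvalue_form[OF RR _ y] k by simp
  also have "\<dots> = (?R *\<^sub>v y) \<bullet> (?R *\<^sub>v y)" by (rule gram_matrix_form[OF Rc y])
  also have "\<dots> = (G *\<^sub>v y) \<bullet> (G *\<^sub>v y)"
    using isometry_scalar_prod[OF Q, of "?R *\<^sub>v y"] Rc y Q by (simp add: G)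
  finally show ?thesis .
qed

text \<open>The subtraction of the last residual turns the form of \<open>K\<close> into that of \<open>F F\<^sup>T\<close>, which
the decomposition of \<open>F\<close> diagonalizes in the coordinates \<open>U\<^sup>T x\<close>. At \<open>x = S y\<close> these are the
entries of \<open>G y\<close> for \<open>G = U\<^sup>T S\<close>.\<close>

lemma CholeskyGKS_eigenvalue_bound:
  assumes k: "1 \<le> k" "k < n" and psd: "psd_mat n K"
    and alg: "CholeskyGKS_sRRQR n k f K S" and j: "j < k"
  shows "nth_eigenvalue K (Suc j) * c_coeff n (Suc j) / (1 + f\<^sup>2 * real k * (real n - real k))
    \<le> nth_eigenvalue (transpose_mat S * K * S) (Suc j)"
proof -
  let ?q = "1 + f\<^sup>2 * real k * (real n - real k)"
  obtain s U d V M where greedy: "greedy_pivots n k K s"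
    and svd: "thin_svd n k (chol_factor n k K s) U d V"
    and qr: "sRRQR k n f (transpose_mat U) M" and S: "S = first_cols k M"
    using alg unfolding CholeskyGKS_sRRQR_def pivoted_cholesky_def by blast
  interpret greedy_cholesky n k K s using psd greedy by unfold_locales
  have U: "U \<in> carrier_mat n k" "transpose_mat U * U = 1\<^sub>m k"
    and d: "\<And>i. i < k \<Longrightarrow> 0 \<le> d i" "\<And>i j. i \<le> j \<Longrightarrow> j < k \<Longrightarrow> d j \<le> d i"
    using svd by (auto simp: thin_svd_def)
  have "M \<in> carrier_mat n n" using qr by (auto simp: sRRQR_def permutation_matrix_def)
  hence Sc: "S \<in> carrier_mat n k" unfolding S by (rule first_cols_carrier)
  have q: "0 < ?q" using k by (intro add_pos_nonneg) auto
  let ?G = "transpose_mat U * S"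
  have G: "?G \<in> carrier_mat k k" using U Sc by simp
  have "(d j)\<^sup>2 * (1 / ?q) \<le> nth_eigenvalue (transpose_mat S * K * S) (Suc j)"
  proof (rule compression_eigenvalue_lower_bound[OF compression_psd[OF psd Sc] G, where d = "\<lambda>l. (d l)\<^sup>2"])
    show "(d b)\<^sup>2 \<le> (d a)\<^sup>2" if "a \<le> b" "b < k" for a b
      using d that by (intro power_mono) auto
    show "1 / ?q * (y \<bullet> y) \<le> (?G *\<^sub>v y) \<bullet> (?G *\<^sub>v y)" if "y \<in> carrier_vec k" for y
      unfolding S by (rule sRRQR_selected_block_lower[OF qr U k that])
    fix y :: "real vec" assume y: "y \<in> carrier_vec k"
    have Sy: "S *\<^sub>v y \<in> carrier_vec n" using Sc y by simp
    have "row ?G l \<bullet> y = col U l \<bullet> (S *\<^sub>v y)" if l: "l < k" for l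
    proof -
      have "?G *\<^sub>v y = transpose_mat U *\<^sub>v (S *\<^sub>v y)" using U Sc y by simp
      from arg_cong[OF this, of "\<lambda>v. v $ l"] show ?thesis using l U by simp
    qed
    hence "(\<Sum>l<k. (d l)\<^sup>2 * (row ?G l \<bullet> y)\<^sup>2) = (\<Sum>l<k. (d l)\<^sup>2 * (col U l \<bullet> (S *\<^sub>v y))\<^sup>2)"
      by (intro sum.cong) auto
    also have "\<dots> \<le> (S *\<^sub>v y) \<bullet> (K *\<^sub>v (S *\<^sub>v y))"
      using chol_factor_form_le[OF Sy] thin_svd_form[OF svd Sy] by simp
    also have "\<dots> = y \<bullet> ((transpose_mat S * K * S) *\<^sub>v y)"
      by (rule compression_form[OF psd_matD(1)[OF psd] Sc y, symmetric])
    finally show "(\<Sum>l<k. (d l)\<^sup>2 * (row ?G l \<bullet> y)\<^sup>2) \<le> y \<bullet> ((transpose_mat S * K * S) *\<^sub>v y)" .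
  qed (use q j in auto)
  moreover have "nth_eigenvalue K (Suc j) * c_coeff n (Suc j) / ?q \<le> (d j)\<^sup>2 * (1 / ?q)"
    using divide_right_mono[OF singular_value_lower_bound[OF svd j], of ?q] q k by simp
  ultimately show ?thesis by linarith
qed

theorem theorem4:
  fixes n k :: nat and K S S_opt :: "real mat" and \<eta> f :: real
  assumes "1 \<le> k" and "k < n"
    and "psd_mat n K"
    and "k \<le> vec_space.rank n K"
    and "\<eta> > 0" and "f > 1"
    and "CholeskyGKS_sRRQR n k f K S"
    and "D_optimal n k K \<eta> S_opt"
  shows "phi_D K \<eta> S_opt \<ge> phi_D K \<eta> S \<and>
    phi_D K \<eta> S \<ge>
      ln (det (1\<^sub>m k + ((1 / \<eta>\<^sup>2) / (1 + f\<^sup>2 * real k * (real n - real k)))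
                        \<cdot>\<^sub>m (Lambda_mat k K * C_mat n k)))"
proof
  obtain M where M: "permutation_matrix n M" and S: "S = first_cols k M"
    using assms(7) by (auto simp: CholeskyGKS_sRRQR_def sRRQR_def)
  have sel: "selection_operator n k S"
    unfolding S using first_cols_permutation_selection[OF M] assms(2) by simp
  thus "phi_D K \<eta> S \<le> phi_D K \<eta> S_opt" using assms(8) by (simp add: D_optimal_def)
  let ?q = "1 + f\<^sup>2 * real k * (real n - real k)"
  let ?N = "transpose_mat S * K * S"
  let ?lam = "\<lambda>i. nth_eigenvalue K (Suc i) * c_coeff n (Suc i)"
  have Sc: "S \<in> carrier_mat n k" using sel by (simp add: selection_operator_def)
  have q: "0 < ?q" using assms(2) by (intro add_pos_nonneg) auto
  have lam: "0 \<le> ?lam i" if "i < k" for i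
    using psd_eigenvalue_nonneg[OF assms(3), of i] that assms(2) by (simp add: c_coeff_def)
  have term_nonneg: "0 \<le> 1 / \<eta>\<^sup>2 / ?q * ?lam i" if "i < k" for i
    using q by (intro mult_nonneg_nonneg[OF _ lam[OF that]]) simp
  have "det (1\<^sub>m k + ((1 / \<eta>\<^sup>2) / ?q) \<cdot>\<^sub>m (Lambda_mat k K * C_mat n k)) = (\<Prod>i<k. 1 + 1 / \<eta>\<^sup>2 / ?q * ?lam i)"
    unfolding Lambda_mat_def C_mat_def mat_diag_diag
    by (subst det_upper_triangular[of _ k]) (auto simp: prod_list_diag_prod mat_diag_def atLeast0LessThan)
  moreover have "det ((1 / \<eta>\<^sup>2) \<cdot>\<^sub>m ?N + 1\<^sub>m (dim_col S)) = (\<Prod>i<k. 1 + 1 / \<eta>\<^sup>2 * nth_eigenvalue ?N (Suc i))"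
    using det_identity_plus_symmetric[OF psd_matD(1,2)[OF compression_psd[OF assms(3) Sc]]] Sc by simp
  moreover have "(\<Prod>i<k. 1 + 1 / \<eta>\<^sup>2 / ?q * ?lam i) \<le> (\<Prod>i<k. 1 + 1 / \<eta>\<^sup>2 * nth_eigenvalue ?N (Suc i))"
  proof (rule prod_mono)
    fix i assume "i \<in> {..<k}"
    hence i: "i < k" by simp
    have "1 / \<eta>\<^sup>2 * (?lam i / ?q) \<le> 1 / \<eta>\<^sup>2 * nth_eigenvalue ?N (Suc i)"
      by (rule mult_left_mono[OF CholeskyGKS_eigenvalue_bound[OF assms(1,2,3,7) i]]) simp
    with term_nonneg[OF i] show "0 \<le> 1 + 1 / \<eta>\<^sup>2 / ?q * ?lam i \<and>
        1 + 1 / \<eta>\<^sup>2 / ?q * ?lam i \<le> 1 + 1 / \<eta>\<^sup>2 * nth_eigenvalue ?N (Suc i)" by simp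
  qed
  moreover have "0 < (\<Prod>i<k. 1 + 1 / \<eta>\<^sup>2 / ?q * ?lam i)"
  proof (rule prod_pos)
    fix i assume "i \<in> {..<k}"
    thus "0 < 1 + 1 / \<eta>\<^sup>2 / ?q * ?lam i"
      using term_nonneg[of i] by (intro add_pos_nonneg) auto
  qed
  ultimately show "ln (det (1\<^sub>m k + ((1 / \<eta>\<^sup>2) / ?q) \<cdot>\<^sub>m (Lambda_mat k K * C_mat n k))) \<le> phi_D K \<eta> S"
    unfolding phi_D_def by simp
qed

end
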